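(* Let $G$ be an $n$-dimensional torus, let $\Gamma$ be a finite $d$-valent graph with vertex set $V$ equipped with a GKM action of $G$ with edge weights $\alpha_e$, and let $f\in K_G(\Gamma)$, $f_p=e^{2\pi i\alpha_p}$, be symplectic. Fix $\xi\in\mathfrak g$ with $\alpha_e(\xi)\neq0$ for all edges $e$. Then the multiplicity with which a weight $\alpha\in\mathbb Z_G^*$ occurs in $Q(f)$ is equal to $$\sum_{p\in V}(-1)^p N_p\bigl(\alpha-\alpha_p+\delta_p^{\#}-\delta_p\bigr).$$
   Context: Torus notation. $\mathfrak g$ is the Lie algebra of $G$, $\mathbb Z_G=\ker(\exp:\mathfrak g\to G)$, and $\mathbb Z_G^*=\{\alpha\in\mathfrak g^*:\alpha(v)\in\mathbb Z\text{ for all }v\in\mathbb Z_G\}$ is the weight lattice. For $\alpha\in\mathbb Z_G^*$, $e^{2\pi i\alpha}:G\to S^1$ is the character $\exp(x)\mapsto e^{2\pi i\alpha(x)}$. For a compact commutative Lie group $H$, $R(H)$ is the representation ring, identified with the character ring: all finite sums $\sum m_k\chi_k$ with $m_k\in\mathbb Z$ and $\chi_k:H\to S^1$ characters. Graph and action. $E$ is the set of oriented edges of $\Gamma$ (each unoriented edge gives two oriented edges). For $e\in E$, $i(e)$ and $t(e)$ are its initial and terminal vertices and $\bar e$ is $e$ with reversed orientation. $d$-valent means each vertex $p$ has exactly $d$ oriented edges $e$ with $i(e)=p$. An action of $G$ on $\Gamma$ assigns to each $e\in E$ a one-dimensional representation $\varrho_e$ with character $\chi_e=e^{2\pi i\alpha_e}$,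 $\alpha_e\in\mathbb Z_G^*$, and to each $p\in V$ a $d$-dimensional representation $\tau_p$, such that, with $G_e=\ker\chi_e$: $\tau_p\simeq\bigoplus_{i(e)=p}\varrho_e$ for all $p$; $\varrho_{\bar e}\simeq\varrho_e^*$ (so $\alpha_{\bar e}=-\alpha_e$); and $\tau_{i(e)}|_{G_e}\simeq\tau_{t(e)}|_{G_e}$ for all $e$. The action is GKM if for any two distinct oriented edges $e_1\ne e_2$ with $i(e_1)=i(e_2)$ the weights $\alpha_{e_1},\alpha_{e_2}$ are linearly independent. $K_G(\Gamma)$ is the set of functions $f:V\to R(G)$, $p\mapsto f_p$, with $r_e f_{i(e)}=r_e f_{t(e)}$ for every edge $e$, where $r_e:R(G)\to R(G_e)$ is restriction. Symplectic. Suppose $f\in K_G(\Gamma)$ has the form $f_p=e^{2\pi i\alpha_p}$ with $\alpha_p\in\mathbb Z_G^*$. Then for every oriented edge $e$ from $p$ to $q$ one has $\alpha_q-\alpha_p=m_e\alpha_e$ for some integer $m_e$; $f$ is symplectic if $m_e>0$ for all $e$. $Q(f)$ is the virtual representation of $G$ with character $\chi(f)=\sum_{p\in V}f_p\prod_{i(e)=p}(1-e^{2\pi i\alpha_e})^{-1}$, which is known to lie in $R(G)$. Writing $\chi(f)=\sum_\alpha m_\alpha e^{2\pi i\alpha}$, the multiplicity with which $\alpha$ occurs in $Q(f)$ is $m_\alpha$. Data attached to a vertex $p$ (depending on $\xi$). $\mathcal E_p=\{e\in E: p \text{ is a vertex of } e \text{ and } \alpha_e(\xi)>0\}$; $\sigma_p$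 is the number of $e\in\mathcal E_p$ with $p=t(e)$. For $e\in\mathcal E_p$, $(-1)^e=1$ if $p=i(e)$ and $(-1)^e=-1$ if $p=t(e)$. Put $(-1)^p=\prod_{e\in\mathcal E_p}(-1)^e=(-1)^{\sigma_p}$, $\delta_p=\frac12\sum_{e\in\mathcal E_p}\alpha_e$, $\delta_p^{\#}=\frac12\sum_{e\in\mathcal E_p}(-1)^e\alpha_e$. The Kostant partition function $N_p:\mathbb Z_G^*\to\mathbb N$ assigns to $\alpha$ the number of distinct ways of writing $\alpha=\sum_{e\in\mathcal E_p}n_e\alpha_e$ with non-negative integers $n_e$, i.e. the number of such families $(n_e)_{e\in\mathcal E_p}$. *)

theory Defs
  imports
    "HOL-Analysis.Analysis"
    "HOL-Algebra.Algebra"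
    "Jordan_Normal_Form.Matrix"
    "Graph_Theory.Bidirected_Digraph"
begin

section \<open>Tori\<close>

text \<open>
  A compact commutative group together with its topology, its Lie algebra (the type \<open>'g\<close>) and
  its exponential map.
\<close>

record ('a, 'g) lie_group = "'a monoid" +
  gtop :: "'a topology"
  gexp :: "'g \<Rightarrow> 'a"

definition integral_lattice :: "('a, 'g::euclidean_space, 'm) lie_group_scheme \<Rightarrow> 'g set" where
  "integral_lattice G = {v. gexp G v = \<one>\<^bsub>G\<^esub>}"

text \<open>
  The assumptions say that the exponential map induces an isomorphism of topological groups
  from the quotient of \<open>'g\<close> by the integral lattice onto \<open>G\<close>, and that this quotient is a
  torus: the kernel is discrete and, by compactness, of full rank.
\<close>

locale torus = comm_group G
  for G :: "('a, 'g::euclidean_space, 'm) lie_group_scheme" (structure) and n :: nat +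
  assumes dimension: "DIM('g) = n"
    and topspace_gtop: "topspace (gtop G) = carrier G"
    and compact_gtop: "compact_space (gtop G)"
    and Hausdorff_gtop: "Hausdorff_space (gtop G)"
    and gexp_add: "\<And>x y. gexp G (x + y) = gexp G x \<otimes> gexp G y"
    and range_gexp: "range (gexp G) = carrier G"
    and continuous_gexp: "continuous_map euclidean (gtop G) (gexp G)"
    and open_gexp: "open_map euclidean (gtop G) (gexp G)"
    and discrete_kernel: "discrete (integral_lattice G)"

text \<open>
  Functionals on the Lie algebra are elements of \<open>'g \<Rightarrow>\<^sub>L real\<close>; in finite dimension
  boundedness is automatic.
\<close>

definition weight_lattice ::
    "('a, 'g::euclidean_space, 'm) lie_group_scheme \<Rightarrow> ('g \<Rightarrow>\<^sub>L real) set" where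
  "weight_lattice G = {\<alpha>. \<forall>v\<in>integral_lattice G. blinfun_apply \<alpha> v \<in> \<int>}"

text \<open>
  The character sending \<open>exp x\<close> to \<open>cis (2 * pi * \<alpha> x)\<close>. For \<open>\<alpha>\<close> in the weight lattice
  the value does not depend on the preimage under \<open>exp\<close> chosen by \<open>inv_into\<close>.
\<close>

definition weight_char ::
    "('a, 'g::euclidean_space, 'm) lie_group_scheme \<Rightarrow> ('g \<Rightarrow>\<^sub>L real) \<Rightarrow> 'a \<Rightarrow> complex" where
  "weight_char G \<alpha> = (\<lambda>g\<in>carrier G. cis (2 * pi * blinfun_apply \<alpha> (inv_into UNIV (gexp G) g)))"


section \<open>Characters and representations of closed subgroups\<close>

text \<open>
  Functions on a subgroup \<open>H\<close> are extensional, so that restriction from \<open>G\<close> to \<open>H\<close> is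
  \<open>\<lambda>\<phi>. restrict \<phi> H\<close> and equality of restrictions is equality of functions.
\<close>

definition circle_group :: "complex monoid" where
  "circle_group = \<lparr>carrier = sphere 0 1, mult = (*), one = 1\<rparr>"

definition characters ::
    "('a, 'g::euclidean_space, 'm) lie_group_scheme \<Rightarrow> 'a set \<Rightarrow> ('a \<Rightarrow> complex) set" where
  "characters G H = {\<psi> \<in> extensional H.
     \<psi> \<in> hom (G\<lparr>carrier := H\<rparr>) circle_group \<and>
     continuous_map (subtopology (gtop G) H) euclidean \<psi>}"

definition character_ring ::
    "('a, 'g::euclidean_space, 'm) lie_group_scheme \<Rightarrow> 'a set \<Rightarrow> ('a \<Rightarrow> complex) set" where
  "character_ring G H = {\<phi> \<in> extensional H.
     \<exists>S (m :: ('a \<Rightarrow> complex) \<Rightarrow> int). finite S \<and> S \<subseteq> characters G H \<and>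
       (\<forall>h\<in>H. \<phi> h = (\<Sum>\<psi>\<in>S. of_int (m \<psi>) * \<psi> h))}"

definition representation ::
    "('a, 'g::euclidean_space, 'm) lie_group_scheme \<Rightarrow> 'a set \<Rightarrow> nat \<Rightarrow>
     ('a \<Rightarrow> complex mat) \<Rightarrow> bool" where
  "representation G H k \<rho> \<longleftrightarrow>
     \<rho> \<in> hom (G\<lparr>carrier := H\<rparr>) (units_of (ring_mat TYPE(complex) k ())) \<and>
     (\<forall>i<k. \<forall>j<k. continuous_map (subtopology (gtop G) H) euclidean (\<lambda>g. \<rho> g $$ (i, j)))"

definition rep_character :: "nat \<Rightarrow> ('a \<Rightarrow> complex mat) \<Rightarrow> 'a \<Rightarrow> complex" where
  "rep_character k \<rho> g = (\<Sum>i<k. \<rho> g $$ (i, i))"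

definition equivalent_reps ::
    "'a set \<Rightarrow> nat \<Rightarrow> ('a \<Rightarrow> complex mat) \<Rightarrow> ('a \<Rightarrow> complex mat) \<Rightarrow> bool" where
  "equivalent_reps H k \<rho> \<sigma> \<longleftrightarrow>
     (\<exists>P \<in> Units (ring_mat TYPE(complex) k ()). \<forall>h\<in>H. P * \<rho> h = \<sigma> h * P)"

definition direct_sum_rep :: "('e \<Rightarrow> 'a \<Rightarrow> complex mat) \<Rightarrow> 'e list \<Rightarrow> 'a \<Rightarrow> complex mat" where
  "direct_sum_rep \<rho> es g = diag_block_mat (map (\<lambda>e. \<rho> e g) es)"

definition dual_rep ::
    "('a, 'm) monoid_scheme \<Rightarrow> ('a \<Rightarrow> complex mat) \<Rightarrow> 'a \<Rightarrow> complex mat" where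
  "dual_rep G \<rho> g = transpose_mat (\<rho> (inv\<^bsub>G\<^esub> g))"


section \<open>Torus actions on graphs\<close>

text \<open>
  Arcs are the oriented edges and \<open>arev\<close> is reversal of orientation, a fixed-point free
  involution on the arcs; \<open>tail\<close> and \<open>head\<close> are the initial and the terminal vertex. Parallel
  edges are allowed.
\<close>

locale valent_graph = bidirected_digraph \<Gamma> arev + fin_digraph \<Gamma>
  for \<Gamma> :: "('v, 'e) pre_digraph" and arev :: "'e \<Rightarrow> 'e" and d :: nat +
  assumes valency: "\<And>p. p \<in> verts \<Gamma> \<Longrightarrow> out_degree \<Gamma> p = d"

definition edge_kernel ::
    "('a, 'g::euclidean_space, 'm) lie_group_scheme \<Rightarrow> ('e \<Rightarrow> 'g \<Rightarrow>\<^sub>L real) \<Rightarrow> 'e \<Rightarrow> 'a set" where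
  "edge_kernel G \<alpha> e = kernel G circle_group (weight_char G (\<alpha> e))"

locale graph_action = torus G n + valent_graph \<Gamma> arev d
  for G :: "('a, 'g::euclidean_space, 'm) lie_group_scheme" (structure) and n :: nat
    and \<Gamma> :: "('v, 'e) pre_digraph" and arev :: "'e \<Rightarrow> 'e" and d :: nat +
  fixes \<alpha> :: "'e \<Rightarrow> 'g \<Rightarrow>\<^sub>L real"
    and \<rho> :: "'e \<Rightarrow> 'a \<Rightarrow> complex mat"
    and \<tau> :: "'v \<Rightarrow> 'a \<Rightarrow> complex mat"
  assumes weight: "\<And>e. e \<in> arcs \<Gamma> \<Longrightarrow> \<alpha> e \<in> weight_lattice G"
    and edge_rep: "\<And>e. e \<in> arcs \<Gamma> \<Longrightarrow> representation G (carrier G) 1 (\<rho> e)"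
    and edge_char: "\<And>e g. e \<in> arcs \<Gamma> \<Longrightarrow> g \<in> carrier G \<Longrightarrow>
          rep_character 1 (\<rho> e) g = weight_char G (\<alpha> e) g"
    and vertex_rep: "\<And>p. p \<in> verts \<Gamma> \<Longrightarrow> representation G (carrier G) d (\<tau> p)"
    and vertex_rep_sum: "\<And>p. p \<in> verts \<Gamma> \<Longrightarrow>
          \<exists>es. distinct es \<and> set es = out_arcs \<Gamma> p \<and>
               equivalent_reps (carrier G) d (\<tau> p) (direct_sum_rep \<rho> es)"
    and edge_rep_rev: "\<And>e. e \<in> arcs \<Gamma> \<Longrightarrow>
          equivalent_reps (carrier G) 1 (\<rho> (arev e)) (dual_rep G (\<rho> e))"
    and vertex_reps_agree: "\<And>e. e \<in> arcs \<Gamma> \<Longrightarrow>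
          equivalent_reps (edge_kernel G \<alpha> e) d (\<tau> (tail \<Gamma> e)) (\<tau> (head \<Gamma> e))"

text \<open>Two weights are linearly independent if they are distinct and form an independent set.\<close>

locale GKM_action = graph_action +
  assumes GKM: "\<And>e1 e2. e1 \<in> arcs \<Gamma> \<Longrightarrow> e2 \<in> arcs \<Gamma> \<Longrightarrow> e1 \<noteq> e2 \<Longrightarrow> tail \<Gamma> e1 = tail \<Gamma> e2 \<Longrightarrow>
      \<alpha> e1 \<noteq> \<alpha> e2 \<and> independent {\<alpha> e1, \<alpha> e2}"

definition K_ring ::
    "('a, 'g::euclidean_space, 'm) lie_group_scheme \<Rightarrow> ('v, 'e) pre_digraph \<Rightarrow>
     ('e \<Rightarrow> 'g \<Rightarrow>\<^sub>L real) \<Rightarrow> ('v \<Rightarrow> 'a \<Rightarrow> complex) set" where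
  "K_ring G \<Gamma> \<alpha> = {f \<in> verts \<Gamma> \<rightarrow>\<^sub>E character_ring G (carrier G).
     \<forall>e\<in>arcs \<Gamma>. restrict (f (tail \<Gamma> e)) (edge_kernel G \<alpha> e) =
                 restrict (f (head \<Gamma> e)) (edge_kernel G \<alpha> e)}"

text \<open>\<open>f\<close> is symplectic, with \<open>a p\<close> the exponent of \<open>f p\<close>.\<close>

definition symplectic ::
    "('a, 'g::euclidean_space, 'm) lie_group_scheme \<Rightarrow> ('v, 'e) pre_digraph \<Rightarrow>
     ('e \<Rightarrow> 'g \<Rightarrow>\<^sub>L real) \<Rightarrow> ('v \<Rightarrow> 'a \<Rightarrow> complex) \<Rightarrow> ('v \<Rightarrow> 'g \<Rightarrow>\<^sub>L real) \<Rightarrow> bool" where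
  "symplectic G \<Gamma> \<alpha> f a \<longleftrightarrow>
     f \<in> K_ring G \<Gamma> \<alpha> \<and>
     (\<forall>p\<in>verts \<Gamma>. a p \<in> weight_lattice G \<and> f p = weight_char G (a p)) \<and>
     (\<forall>e\<in>arcs \<Gamma>. \<exists>m::int. m > 0 \<and> a (head \<Gamma> e) - a (tail \<Gamma> e) = of_int m *\<^sub>R \<alpha> e)"


section \<open>The virtual representation \<open>Q(f)\<close> and its multiplicities\<close>

text \<open>
  The localization sum makes sense where no denominator vanishes. This is a dense open subset
  of the torus when all weights are nonzero, so at most one element of the character ring
  extends the sum.
\<close>

definition regular_elements ::
    "('a, 'g::euclidean_space, 'm) lie_group_scheme \<Rightarrow> ('v, 'e) pre_digraph \<Rightarrow>
     ('e \<Rightarrow> 'g \<Rightarrow>\<^sub>L real) \<Rightarrow> 'a set" where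
  "regular_elements G \<Gamma> \<alpha> = {g \<in> carrier G. \<forall>e\<in>arcs \<Gamma>. weight_char G (\<alpha> e) g \<noteq> 1}"

definition Q_character ::
    "('a, 'g::euclidean_space, 'm) lie_group_scheme \<Rightarrow> ('v, 'e) pre_digraph \<Rightarrow>
     ('e \<Rightarrow> 'g \<Rightarrow>\<^sub>L real) \<Rightarrow> ('v \<Rightarrow> 'a \<Rightarrow> complex) \<Rightarrow> 'a \<Rightarrow> complex" where
  "Q_character G \<Gamma> \<alpha> f = (THE \<phi>. \<phi> \<in> character_ring G (carrier G) \<and>
     (\<forall>g\<in>regular_elements G \<Gamma> \<alpha>.
        \<phi> g = (\<Sum>p\<in>verts \<Gamma>. f p g * (\<Prod>e\<in>out_arcs \<Gamma> p. inverse (1 - weight_char G (\<alpha> e) g)))))"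

definition weight_multiplicity ::
    "('a, 'g::euclidean_space, 'm) lie_group_scheme \<Rightarrow> ('a \<Rightarrow> complex) \<Rightarrow> ('g \<Rightarrow>\<^sub>L real) \<Rightarrow> int" where
  "weight_multiplicity G \<phi> = (THE m. finite {\<beta>. m \<beta> \<noteq> 0} \<and> {\<beta>. m \<beta> \<noteq> 0} \<subseteq> weight_lattice G \<and>
     (\<forall>g\<in>carrier G. \<phi> g = (\<Sum>\<beta> | m \<beta> \<noteq> 0. of_int (m \<beta>) * weight_char G \<beta> g)))"


section \<open>Data attached to a vertex\<close>

definition positive_edges ::
    "('v, 'e) pre_digraph \<Rightarrow> ('e \<Rightarrow> 'g::euclidean_space \<Rightarrow>\<^sub>L real) \<Rightarrow> 'g \<Rightarrow> 'v \<Rightarrow> 'e set" where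
  "positive_edges \<Gamma> \<alpha> \<xi> p =
     {e \<in> arcs \<Gamma>. (tail \<Gamma> e = p \<or> head \<Gamma> e = p) \<and> blinfun_apply (\<alpha> e) \<xi> > 0}"

text \<open>A GKM action excludes loops, so the two cases below are disjoint there.\<close>

definition edge_sign :: "('v, 'e) pre_digraph \<Rightarrow> 'v \<Rightarrow> 'e \<Rightarrow> int" where
  "edge_sign \<Gamma> p e = (if tail \<Gamma> e = p then 1 else - 1)"

definition vertex_sign ::
    "('v, 'e) pre_digraph \<Rightarrow> ('e \<Rightarrow> 'g::euclidean_space \<Rightarrow>\<^sub>L real) \<Rightarrow> 'g \<Rightarrow> 'v \<Rightarrow> int" where
  "vertex_sign \<Gamma> \<alpha> \<xi> p = (\<Prod>e\<in>positive_edges \<Gamma> \<alpha> \<xi> p. edge_sign \<Gamma> p e)"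

definition delta ::
    "('v, 'e) pre_digraph \<Rightarrow> ('e \<Rightarrow> 'g::euclidean_space \<Rightarrow>\<^sub>L real) \<Rightarrow> 'g \<Rightarrow> 'v \<Rightarrow> 'g \<Rightarrow>\<^sub>L real" where
  "delta \<Gamma> \<alpha> \<xi> p = (1 / 2) *\<^sub>R (\<Sum>e\<in>positive_edges \<Gamma> \<alpha> \<xi> p. \<alpha> e)"

definition delta_sharp ::
    "('v, 'e) pre_digraph \<Rightarrow> ('e \<Rightarrow> 'g::euclidean_space \<Rightarrow>\<^sub>L real) \<Rightarrow> 'g \<Rightarrow> 'v \<Rightarrow> 'g \<Rightarrow>\<^sub>L real" where
  "delta_sharp \<Gamma> \<alpha> \<xi> p =
     (1 / 2) *\<^sub>R (\<Sum>e\<in>positive_edges \<Gamma> \<alpha> \<xi> p. of_int (edge_sign \<Gamma> p e) *\<^sub>R \<alpha> e)"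

text \<open>
  The families counted form a finite set, since every \<open>\<alpha> e\<close> occurring is positive on \<open>\<xi>\<close>.
\<close>

definition kostant_partition ::
    "('v, 'e) pre_digraph \<Rightarrow> ('e \<Rightarrow> 'g::euclidean_space \<Rightarrow>\<^sub>L real) \<Rightarrow> 'g \<Rightarrow> 'v \<Rightarrow>
     ('g \<Rightarrow>\<^sub>L real) \<Rightarrow> nat" where
  "kostant_partition \<Gamma> \<alpha> \<xi> p \<beta> =
     card {k \<in> positive_edges \<Gamma> \<alpha> \<xi> p \<rightarrow>\<^sub>E (UNIV :: nat set).
           \<beta> = (\<Sum>e\<in>positive_edges \<Gamma> \<alpha> \<xi> p. real (k e) *\<^sub>R \<alpha> e)}"

end

theory Submission
  imports Defs "HOL-Library.Poly_Mapping"
begin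

text \<open>
  Put the localization sum over the common denominator \<open>D\<close>, the product of \<open>1 - exp \<alpha>\<close> over the
  weights \<open>\<alpha>\<close> of all oriented edges, in the group ring of the dual of the Lie algebra. The numerator
  \<open>N\<close> is divisible by \<open>D\<close>: for a fixed weight \<open>\<alpha>\<close>, the edges parallel to \<open>\<alpha>\<close> pair off the vertices
  they meet, and since the isotropy representations at the two ends of an edge agree on the kernel
  of its character, the poles of the two terms along that kernel cancel. So \<open>D\<close> divides \<open>N\<close> times
  factors \<open>1 - exp \<beta>\<close> with \<open>\<beta>\<close> independent of \<open>\<alpha>\<close>, and these are coprime to \<open>1 - exp \<alpha>\<close>. Hence
  \<open>N = D M\<close> with \<open>M\<close> a Laurent polynomial, the character of \<open>Q(f)\<close>. On the other hand, expanding
  each term of the localization sum as a geometric series in the direction \<open>\<xi>\<close> gives the alternating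
  sum \<open>F\<close> of partition functions as a formal solution of \<open>D F = N\<close>. The support of \<open>F - M\<close> is bounded
  below in the direction \<open>\<xi>\<close>, and on such series multiplication by \<open>D\<close> is injective, so \<open>F = M\<close>.
\<close>

section \<open>Group rings\<close>

text \<open>The type \<open>'b \<Rightarrow>\<^sub>0 int\<close> serves as the group ring, with
  convolution as product. One construction covers two uses: a multiplicative \<open>u\<close> with
  complex values gives evaluation at a point, and a translate of a coefficient function as
  \<open>u\<close> gives the action on formal series.\<close>

definition lin_ext :: "('b \<Rightarrow> 'c::comm_ring_1) \<Rightarrow> ('b \<Rightarrow>\<^sub>0 int) \<Rightarrow> 'c" where
  "lin_ext u P = (\<Sum>\<beta>\<in>Poly_Mapping.keys P. of_int (Poly_Mapping.lookup P \<beta>) * u \<beta>)"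

lemma lin_ext_superset:
  assumes "finite A" "Poly_Mapping.keys P \<subseteq> A"
  shows "lin_ext u P = (\<Sum>\<beta>\<in>A. of_int (Poly_Mapping.lookup P \<beta>) * u \<beta>)"
  unfolding lin_ext_def using assms by (intro sum.mono_neutral_left) (auto simp: in_keys_iff)

lemma lin_ext_add: "lin_ext u (P + Q) = lin_ext u P + lin_ext u Q"
proof -
  let ?A = "Poly_Mapping.keys P \<union> Poly_Mapping.keys Q"
  show ?thesis
    using Poly_Mapping.keys_add[of P Q]
    by (simp add: lin_ext_superset[of ?A] lookup_add sum.distrib distrib_right)
qed

lemma lin_ext_uminus: "lin_ext u (- P) = - lin_ext u P"
  by (simp add: lin_ext_def sum_negf)

lemma lin_ext_diff: "lin_ext u (P - Q) = lin_ext u P - lin_ext u Q"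
  using lin_ext_add[of u P "- Q"] by (simp add: lin_ext_uminus)

lemma lin_ext_single: "lin_ext u (Poly_Mapping.single \<beta> c) = of_int c * u \<beta>"
  by (simp add: lin_ext_def)

lemma lin_ext_zero [simp]: "lin_ext u 0 = 0"
  by (simp add: lin_ext_def)

lemma lin_ext_one: "lin_ext u 1 = u 0"
  by (metis lin_ext_single mult_1 of_int_1 single_one)

lemma lin_ext_sum: "lin_ext u (\<Sum>i\<in>I. P i) = (\<Sum>i\<in>I. lin_ext u (P i))"
  by (induction I rule: infinite_finite_induct) (auto simp: lin_ext_add)

lemma lin_ext_fun_sum: "lin_ext (\<lambda>\<beta>. \<Sum>i\<in>I. u i \<beta>) P = (\<Sum>i\<in>I. lin_ext (u i) P)"
  unfolding lin_ext_def sum_distrib_left by (rule sum.swap)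

lemma lin_ext_fun_cmult: "lin_ext (\<lambda>\<beta>. c * u \<beta>) P = c * lin_ext u P"
  by (simp add: lin_ext_def sum_distrib_left mult_ac)

lemma sum_single_keys:
  "P = (\<Sum>\<beta>\<in>Poly_Mapping.keys P. Poly_Mapping.single \<beta> (Poly_Mapping.lookup P \<beta>))"
  by (rule poly_mapping_eqI) (auto simp: lookup_sum lookup_single when_def in_keys_iff)

lemma poly_mapping_additive_induct [case_names zero single add]:
  fixes P :: "'b \<Rightarrow>\<^sub>0 int"
  assumes "\<phi> 0" and "\<And>\<beta> c. \<phi> (Poly_Mapping.single \<beta> c)"
    and "\<And>P Q. \<phi> P \<Longrightarrow> \<phi> Q \<Longrightarrow> \<phi> (P + Q)"
  shows "\<phi> P"
proof -
  have "\<phi> (\<Sum>\<beta>\<in>S. Poly_Mapping.single \<beta> (Poly_Mapping.lookup P \<beta>))" for S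
    by (induction S rule: infinite_finite_induct) (auto intro: assms)
  then show ?thesis
    by (metis sum_single_keys)
qed

text \<open>Both sides are additive in \<open>P\<close> and in \<open>Q\<close>, so monomials
  suffice. This iterated form yields both the multiplicativity of evaluations and the module law of
  \<open>formal_action\<close>.\<close>

lemma lin_ext_mult:
  fixes P Q :: "'b::comm_monoid_add \<Rightarrow>\<^sub>0 int"
  shows "lin_ext u (P * Q) = lin_ext (\<lambda>\<gamma>. lin_ext (\<lambda>\<delta>. u (\<gamma> + \<delta>)) Q) P"
proof (induction P rule: poly_mapping_additive_induct)
  case (single \<beta> c)
  show ?case
    by (induction Q rule: poly_mapping_additive_induct)
      (auto simp: lin_ext_single mult_single lin_ext_add distrib_left distrib_right ac_simps)
qed (auto simp: lin_ext_add distrib_right)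

lemma lin_ext_mult_hom:
  fixes P Q :: "'b::comm_monoid_add \<Rightarrow>\<^sub>0 int"
  assumes "\<And>\<beta> \<gamma>. u (\<beta> + \<gamma>) = u \<beta> * u \<gamma>"
  shows "lin_ext u (P * Q) = lin_ext u P * lin_ext u Q"
  unfolding lin_ext_mult assms lin_ext_fun_cmult by (simp add: lin_ext_def sum_distrib_right mult_ac)

lemma lin_ext_prod_hom:
  fixes P :: "'i \<Rightarrow> 'b::comm_monoid_add \<Rightarrow>\<^sub>0 int"
  assumes "\<And>\<beta> \<gamma>. u (\<beta> + \<gamma>) = u \<beta> * u \<gamma>" and "u 0 = 1"
  shows "lin_ext u (\<Prod>i\<in>I. P i) = (\<Prod>i\<in>I. lin_ext u (P i))"
  by (induction I rule: infinite_finite_induct) (auto simp: lin_ext_one assms lin_ext_mult_hom)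

section \<open>Exponentials and the denominator factors\<close>

abbreviation expo :: "'b \<Rightarrow> 'b \<Rightarrow>\<^sub>0 int" where
  "expo \<gamma> \<equiv> Poly_Mapping.single \<gamma> 1"

definition bino :: "'b::comm_monoid_add \<Rightarrow> 'b \<Rightarrow>\<^sub>0 int" where
  "bino \<gamma> = 1 - expo \<gamma>"

lemma expo_add: "expo (\<beta> + \<gamma>) = expo \<beta> * expo \<gamma>"
  by (simp add: mult_single)

lemma expo_sum: "expo (\<Sum>i\<in>I. u i) = (\<Prod>i\<in>I. expo (u i))"
  by (induction I rule: infinite_finite_induct) (auto simp: expo_add)

lemma lookup_single_mult:
  fixes P :: "'b::ab_group_add \<Rightarrow>\<^sub>0 int"
  shows "Poly_Mapping.lookup (Poly_Mapping.single \<gamma> c * P) \<beta> = c * Poly_Mapping.lookup P (\<beta> - \<gamma>)"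
  by (induction P rule: poly_mapping_additive_induct)
    (auto simp: mult_single lookup_single when_def lookup_add distrib_left algebra_simps)

lemma lookup_bino_mult:
  fixes P :: "'b::ab_group_add \<Rightarrow>\<^sub>0 int"
  shows "Poly_Mapping.lookup (bino \<gamma> * P) \<beta> =
    Poly_Mapping.lookup P \<beta> - Poly_Mapping.lookup P (\<beta> - \<gamma>)"
  by (simp add: bino_def left_diff_distrib lookup_minus lookup_single_mult)

text \<open>Reversing an edge changes its denominator factor only by a unit of the group ring; the
  sign and the shift in the final formula both come from this unit.\<close>

lemma bino_uminus:
  fixes \<gamma> :: "'b::ab_group_add"
  shows "bino (- \<gamma>) = - expo (- \<gamma>) * bino \<gamma>"
  by (simp add: bino_def right_diff_distrib mult_single)

section \<open>Real gradings and divisibility by a binomial\<close>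

definition piece :: "('b \<Rightarrow> real) \<Rightarrow> real \<Rightarrow> ('b \<Rightarrow>\<^sub>0 int) \<Rightarrow> ('b \<Rightarrow>\<^sub>0 int)" where
  "piece t s P = Poly_Mapping.mapp (\<lambda>\<beta> c. c when t \<beta> = s) P"

lemma lookup_piece: "Poly_Mapping.lookup (piece t s P) \<beta> = (Poly_Mapping.lookup P \<beta> when t \<beta> = s)"
  by (auto simp: piece_def lookup_mapp when_def in_keys_iff)

lemma piece_bino_mult:
  fixes t :: "'b::ab_group_add \<Rightarrow> real"
  assumes "Modules.additive t" and "t \<gamma> = 0"
  shows "piece t s (bino \<gamma> * P) = bino \<gamma> * piece t s P"
  using assms by (intro poly_mapping_eqI)
    (auto simp: lookup_piece lookup_bino_mult when_def additive.diff)

text \<open>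
  The lowest graded piece of \<open>P\<close> is also that of \<open>bino \<delta> * P\<close>, and \<open>bino \<gamma>\<close> has degree 0,
  so \<open>bino \<gamma>\<close> divides it; split it off and repeat.
\<close>
lemma bino_dvd_bino_mult:
  fixes t :: "'b::ab_group_add \<Rightarrow> real"
  assumes t: "Modules.additive t" "t \<gamma> = 0" "t \<delta> > 0"
    and "bino \<gamma> dvd bino \<delta> * P"
  shows "bino \<gamma> dvd P"
  using assms(4)
proof (induction "card (Poly_Mapping.keys P)" arbitrary: P rule: less_induct)
  case less
  show ?case
  proof (cases "P = 0")
    case False
    define s where "s = Min (t ` Poly_Mapping.keys P)"
    have fin: "finite (t ` Poly_Mapping.keys P)" "t ` Poly_Mapping.keys P \<noteq> {}"
      using False by auto
    have smin: "s \<le> t \<beta>" if "\<beta> \<in> Poly_Mapping.keys P" for \<beta>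
      unfolding s_def using that by (intro Min_le) auto
    obtain \<beta> where \<beta>: "\<beta> \<in> Poly_Mapping.keys P" "t \<beta> = s"
      using Min_in[OF fin] unfolding s_def[symmetric] by auto
    obtain Q where Q: "bino \<delta> * P = bino \<gamma> * Q"
      using less.prems by (auto elim: dvdE)
    have "piece t s (bino \<delta> * P) = piece t s P"
    proof (rule poly_mapping_eqI)
      fix \<epsilon>
      have "Poly_Mapping.lookup P (\<epsilon> - \<delta>) = 0" if "t \<epsilon> = s"
        using smin[of "\<epsilon> - \<delta>"] that t by (auto simp: in_keys_iff additive.diff)
      then show "Poly_Mapping.lookup (piece t s (bino \<delta> * P)) \<epsilon> = Poly_Mapping.lookup (piece t s P) \<epsilon>"
        by (auto simp: lookup_piece lookup_bino_mult when_def)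
    qed
    then have dvd: "bino \<gamma> dvd piece t s P"
      using piece_bino_mult[OF t(1,2)] by (metis Q dvd_triv_left)
    have "Poly_Mapping.keys (P - piece t s P) \<subseteq> Poly_Mapping.keys P - {\<beta>}"
      using \<beta> by (auto simp: in_keys_iff lookup_minus lookup_piece when_def split: if_splits)
    then have "card (Poly_Mapping.keys (P - piece t s P)) < card (Poly_Mapping.keys P)"
      using \<beta>(1) by (meson card_Diff1_less card_mono finite_Diff finite_keys le_less_trans)
    moreover have "bino \<gamma> dvd bino \<delta> * (P - piece t s P)"
      using less.prems dvd by (simp add: right_diff_distrib)
    ultimately have "bino \<gamma> dvd P - piece t s P"
      by (rule less.hyps)
    then show ?thesis
      using dvd by (metis diff_add_cancel dvd_add)
  qed auto
qed


text \<open>A nonzero value would repeat at \<open>\<beta> - k \<gamma>\<close> for all natural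
  \<open>k\<close>, where \<open>t\<close> falls below every bound.\<close>

lemma shift_invariant_eq_zero:
  fixes t :: "'b::ab_group_add \<Rightarrow> real" and F :: "'b \<Rightarrow> int"
  assumes t: "Modules.additive t" "t \<gamma> > 0"
    and F: "\<And>\<beta>. F \<beta> = F (\<beta> - \<gamma>)" and bdd: "\<And>\<beta>. F \<beta> \<noteq> 0 \<Longrightarrow> c \<le> t \<beta>"
  shows "F \<beta> = 0"
proof (rule ccontr)
  assume nz: "F \<beta> \<noteq> 0"
  have *: "\<exists>\<delta>. F \<delta> \<noteq> 0 \<and> t \<delta> = t \<beta> - real k * t \<gamma>" for k
  proof (induction k)
    case (Suc k)
    then obtain \<delta> where \<delta>: "F \<delta> \<noteq> 0" "t \<delta> = t \<beta> - real k * t \<gamma>" by blast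
    then show ?case
      using F[of \<delta>] t by (intro exI[of _ "\<delta> - \<gamma>"]) (auto simp: additive.diff algebra_simps)
  qed (use nz in auto)
  obtain k where "t \<beta> - c < real k * t \<gamma>"
    using reals_Archimedean3[OF t(2)] by blast
  with *[of k] bdd show False by force
qed

text \<open>A finite geometric sum for \<open>m \<ge> 0\<close>; for negative \<open>m\<close> the
  binomial differs from that of \<open>- m\<close> by a unit.\<close>

lemma bino_dvd_bino_multiple:
  fixes \<gamma> :: "'b::real_vector"
  shows "bino \<gamma> dvd bino (of_int m *\<^sub>R \<gamma>)"
proof -
  have nat: "bino \<gamma> dvd bino (of_nat k *\<^sub>R \<gamma>)" for k
  proof (induction k)
    case (Suc k)
    have "bino (of_nat (Suc k) *\<^sub>R \<gamma>) = expo \<gamma> * bino (of_nat k *\<^sub>R \<gamma>) + bino \<gamma>"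
      by (simp add: bino_def algebra_simps mult_single)
    then show ?case using Suc by simp
  qed (simp add: bino_def)
  show ?thesis
  proof (cases m)
    case (nonneg k)
    then show ?thesis using nat[of k] by simp
  next
    case (neg k)
    then have "real_of_int m = - real (Suc k)" by simp
    then have "of_int m *\<^sub>R \<gamma> = - (of_nat (Suc k) *\<^sub>R \<gamma>)" by (simp only: scaleR_minus_left)
    then show ?thesis
      using nat[of "Suc k"] by (simp only: bino_uminus dvd_mult)
  qed
qed

text \<open>Modulo \<open>bino \<gamma>\<close> the exponential of \<open>\<gamma>\<close> becomes
  1, so exponents are only seen modulo integer multiples of \<open>\<gamma>\<close>.\<close>

lemma bino_dvd_expo_diff:
  fixes \<gamma> :: "'b::real_vector"
  assumes "\<beta> - \<delta> = of_int m *\<^sub>R \<gamma>"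
  shows "bino \<gamma> dvd expo \<beta> - expo \<delta>"
proof -
  have "expo \<beta> - expo \<delta> = - expo \<delta> * bino (of_int m *\<^sub>R \<gamma>)"
    unfolding assms[symmetric] by (simp add: bino_def algebra_simps mult_single)
  then show ?thesis
    by (metis bino_dvd_bino_multiple dvd_mult)
qed

section \<open>Formal expansions and partition functions\<close>

text \<open>The product of a Laurent polynomial with a formal series. \<open>F\<close> may have any
  support whatever, since the finiteness of \<open>P\<close> makes every coefficient a finite
  sum.\<close>

definition formal_action ::
    "('b::ab_group_add \<Rightarrow>\<^sub>0 int) \<Rightarrow> ('b \<Rightarrow> int) \<Rightarrow> 'b \<Rightarrow> int" where
  "formal_action P F \<beta> = lin_ext (\<lambda>\<gamma>. F (\<beta> - \<gamma>)) P"

lemma formal_action_mult: "formal_action (P * Q) F = formal_action P (formal_action Q F)"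
  by (simp add: formal_action_def lin_ext_mult diff_diff_add fun_eq_iff)

lemma formal_action_one [simp]: "formal_action 1 F = F"
  by (simp add: formal_action_def lin_ext_one fun_eq_iff)

lemma formal_action_expo: "formal_action (expo \<gamma>) F \<beta> = F (\<beta> - \<gamma>)"
  by (simp add: formal_action_def lin_ext_single)

lemma formal_action_bino: "formal_action (bino \<gamma>) F \<beta> = F \<beta> - F (\<beta> - \<gamma>)"
  by (simp add: formal_action_def bino_def lin_ext_diff lin_ext_one lin_ext_single)

lemma formal_action_diff_right: "formal_action P (\<lambda>\<beta>. F \<beta> - H \<beta>) \<beta> = formal_action P F \<beta> - formal_action P H \<beta>"
  by (simp add: formal_action_def lin_ext_def right_diff_distrib sum_subtractf)

lemma formal_action_sum_right:
  "formal_action P (\<lambda>\<beta>. \<Sum>i\<in>I. F i \<beta>) \<beta> = (\<Sum>i\<in>I. formal_action P (F i) \<beta>)"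
  by (simp add: formal_action_def lin_ext_fun_sum)

lemma formal_action_cmult_right: "formal_action P (\<lambda>\<beta>. c * F \<beta>) \<beta> = c * formal_action P F \<beta>"
  by (simp add: formal_action_def lin_ext_fun_cmult)

lemma formal_action_of_int_mult: "formal_action (of_int c * P) F \<beta> = c * formal_action P F \<beta>"
proof -
  have "formal_action (of_int c) H \<beta> = c * H \<beta>" for H
    by (simp add: formal_action_def lin_ext_single flip: single_of_int)
  then show ?thesis
    by (simp add: formal_action_mult)
qed

lemma formal_action_lookup: "formal_action P (Poly_Mapping.lookup Q) = Poly_Mapping.lookup (P * Q)"
proof (rule ext)
  fix \<beta>
  show "formal_action P (Poly_Mapping.lookup Q) \<beta> = Poly_Mapping.lookup (P * Q) \<beta>"
    by (induction P rule: poly_mapping_additive_induct)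
      (auto simp: formal_action_def lin_ext_add lin_ext_single lookup_add lookup_single_mult distrib_right)
qed

text \<open>Uniqueness of expansions bounded below in one direction. Removing one factor at a time,
  the innermost leaves a series invariant under a nontrivial shift, which the bound forces to
  vanish.\<close>

lemma formal_action_prod_bino_eq_0:
  fixes t :: "'b::ab_group_add \<Rightarrow> real"
  assumes t: "Modules.additive t" and "finite I" and nz: "\<And>i. i \<in> I \<Longrightarrow> t (u i) \<noteq> 0"
    and "\<And>\<beta>. formal_action (\<Prod>i\<in>I. bino (u i)) F \<beta> = 0"
    and "\<And>\<beta>. F \<beta> \<noteq> 0 \<Longrightarrow> c \<le> t \<beta>"
  shows "F \<beta> = 0"
  using assms(2-)
proof (induction I arbitrary: F c \<beta> rule: finite_induct)
  case (insert i I)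
  have bino_0: "formal_action (bino (u i)) F \<beta> = 0" for \<beta>
  proof (rule insert.IH)
    show "formal_action (\<Prod>i\<in>I. bino (u i)) (formal_action (bino (u i)) F) \<beta> = 0" for \<beta>
      using insert.prems(2)[of \<beta>] insert.hyps by (simp add: mult.commute flip: formal_action_mult)
    \<comment> \<open>The shifted copy of \<open>F\<close> lives where \<open>t\<close> is at least
      \<open>c + t (u i)\<close>, which lies below \<open>c\<close> if \<open>t (u i)\<close> is
      negative.\<close>
    show "c + min 0 (t (u i)) \<le> t \<beta>" if "formal_action (bino (u i)) F \<beta> \<noteq> 0" for \<beta>
      using that insert.prems(3)[of \<beta>] insert.prems(3)[of "\<beta> - u i"]
      by (cases "F \<beta> = 0") (auto simp: formal_action_bino additive.diff[OF t] min_def)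
  qed (use insert.prems in auto)
  then have inv: "F \<beta> = F (\<beta> - u i)" for \<beta>
    by (simp add: formal_action_bino)
  show ?case
  proof (cases "t (u i) > 0")
    case True
    show ?thesis
      by (rule shift_invariant_eq_zero[where F = F and c = c, OF t True inv insert.prems(3)])
  next
    case False
    then have "t (- u i) > 0"
      using insert.prems(1)[of i] by (simp add: additive.minus[OF t])
    moreover have "F \<beta> = F (\<beta> - (- u i))" for \<beta>
      using inv[of "\<beta> + u i"] by simp
    ultimately show ?thesis
      by (rule shift_invariant_eq_zero[where F = F and c = c, OF t _ _ insert.prems(3)])
  qed
qed simp

section \<open>Partition functions as inverse series\<close>

definition partitions :: "('i \<Rightarrow> 'b::real_vector) \<Rightarrow> 'i set \<Rightarrow> 'b \<Rightarrow> ('i \<Rightarrow> nat) set" where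
  "partitions u I \<beta> = {k \<in> I \<rightarrow>\<^sub>E UNIV. \<beta> = (\<Sum>i\<in>I. real (k i) *\<^sub>R u i)}"

lemma partitions_nonneg:
  assumes t: "linear t" and pos: "\<And>i. i \<in> I \<Longrightarrow> t (u i) > (0::real)" and k: "k \<in> partitions u I \<beta>"
  shows "t \<beta> = (\<Sum>i\<in>I. real (k i) * t (u i))" "t \<beta> \<ge> 0"
proof -
  show "t \<beta> = (\<Sum>i\<in>I. real (k i) * t (u i))"
    using k by (simp add: partitions_def linear_sum[OF t] linear_cmul[OF t])
  also have "\<dots> \<ge> 0"
    by (intro sum_nonneg mult_nonneg_nonneg less_imp_le[OF pos]) auto
  finally show "t \<beta> \<ge> 0" .
qed

text \<open>The coefficient of \<open>u i\<close> contributes a single nonnegative term to a sum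
  equal to \<open>t \<beta>\<close>, which bounds it.\<close>

lemma finite_partitions:
  assumes t: "linear t" and fin: "finite I" and pos: "\<And>i. i \<in> I \<Longrightarrow> t (u i) > (0::real)"
  shows "finite (partitions u I \<beta>)"
proof (rule finite_subset)
  show "partitions u I \<beta> \<subseteq> (\<Pi>\<^sub>E i\<in>I. {..nat \<lceil>t \<beta> / t (u i)\<rceil>})"
  proof
    fix k assume k: "k \<in> partitions u I \<beta>"
    have "k i \<le> nat \<lceil>t \<beta> / t (u i)\<rceil>" if i: "i \<in> I" for i
    proof -
      have "real (k i) * t (u i) \<le> (\<Sum>i\<in>I. real (k i) * t (u i))"
        using fin i by (intro member_le_sum mult_nonneg_nonneg less_imp_le[OF pos]) auto
      also have "\<dots> = t \<beta>"
        using partitions_nonneg(1)[OF t pos k] by simp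
      finally have "real (k i) \<le> t \<beta> / t (u i)"
        using pos[OF i] by (simp add: pos_le_divide_eq)
      then show ?thesis
        using real_nat_ceiling_ge order_trans of_nat_le_iff by blast
    qed
    then show "k \<in> (\<Pi>\<^sub>E i\<in>I. {..nat \<lceil>t \<beta> / t (u i)\<rceil>})"
      using k by (auto simp: partitions_def PiE_iff)
  qed
  show "finite (\<Pi>\<^sub>E i\<in>I. {..nat \<lceil>t \<beta> / t (u i)\<rceil>})"
    using fin by (intro finite_PiE) auto
qed

lemma card_eq_card_not_plus_card:
  assumes "finite A" shows "card A = card {x \<in> A. \<not> \<phi> x} + card {x \<in> A. \<phi> x}"
  using assms by (subst card_Un_disjoint[symmetric]) (auto intro: arg_cong[where f = card])

text \<open>Families with a positive coefficient at \<open>i\<close> correspond to families for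
  \<open>\<beta> - u i\<close> by removing one copy of \<open>u i\<close>; those with coefficient 0
  correspond to families over \<open>I\<close>. In terms of series, multiplication by
  \<open>bino (u i)\<close> removes \<open>i\<close> from the index set.\<close>

lemma card_partitions_insert:
  fixes u :: "'i \<Rightarrow> 'b::real_vector"
  assumes t: "linear t" and fin: "finite I" and i: "i \<notin> I"
    and pos: "\<And>j. j \<in> insert i I \<Longrightarrow> t (u j) > (0::real)"
  shows "card (partitions u (insert i I) \<beta>) =
    card (partitions u (insert i I) (\<beta> - u i)) + card (partitions u I \<beta>)"
proof -
  define s where "s k = (\<Sum>j\<in>I. real (k j) *\<^sub>R u j)" for k :: "'i \<Rightarrow> nat"
  have mem: "k \<in> partitions u (insert i I) \<delta> \<longleftrightarrow>
      k \<in> extensional (insert i I) \<and> \<delta> = real (k i) *\<^sub>R u i + s k" for k \<delta>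
    using fin i by (simp add: partitions_def PiE_iff s_def)
  have mem': "k \<in> partitions u I \<delta> \<longleftrightarrow> k \<in> extensional I \<and> \<delta> = s k" for k \<delta>
    by (simp add: partitions_def PiE_iff s_def)
  have s_upd: "s (k(i := m)) = s k" for k m
    using i unfolding s_def by (intro sum.cong) auto
  have ext: "k(i := m) \<in> extensional (insert i I)"
    if "k \<in> extensional I \<or> k \<in> extensional (insert i I)" for k :: "'i \<Rightarrow> nat" and m
    using that by (auto simp: extensional_def)
  let ?A = "{k \<in> partitions u (insert i I) \<beta>. k i \<noteq> 0}"
  let ?B = "{k \<in> partitions u (insert i I) \<beta>. k i = 0}"
  have fin': "finite (partitions u (insert i I) \<beta>)"
    by (rule finite_partitions[OF t]) (use fin in simp, rule pos)
  have "card (partitions u (insert i I) \<beta>) = card ?A + card ?B"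
    by (rule card_eq_card_not_plus_card[OF fin'])
  moreover have "bij_betw (\<lambda>k. k(i := k i + 1)) (partitions u (insert i I) (\<beta> - u i)) ?A"
  proof (rule bij_betwI[where g = "\<lambda>k. k(i := k i - 1)"])
    show "(\<lambda>k. k(i := k i + 1)) \<in> partitions u (insert i I) (\<beta> - u i) \<rightarrow> ?A"
    proof
      fix k assume "k \<in> partitions u (insert i I) (\<beta> - u i)"
      then have "k \<in> extensional (insert i I)" and "\<beta> - u i = real (k i) *\<^sub>R u i + s k"
        unfolding mem by simp_all
      moreover from this have "\<beta> = u i + (real (k i) *\<^sub>R u i + s k)"
        by (simp only: diff_eq_eq add.commute)
      ultimately show "k(i := k i + 1) \<in> ?A"
        by (simp add: mem s_upd ext scaleR_add_left add.assoc)
    qed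
    show "(\<lambda>k. k(i := k i - 1)) \<in> ?A \<rightarrow> partitions u (insert i I) (\<beta> - u i)"
    proof
      fix k assume "k \<in> ?A"
      then have "k \<in> extensional (insert i I)" "\<beta> = real (k i) *\<^sub>R u i + s k" "k i \<noteq> 0"
        unfolding mem by simp_all
      moreover have "real (k i - 1) = real (k i) - 1"
        using \<open>k i \<noteq> 0\<close> by (simp add: of_nat_diff)
      ultimately show "k(i := k i - 1) \<in> partitions u (insert i I) (\<beta> - u i)"
        by (simp add: mem s_upd ext scaleR_diff_left)
    qed
    show "(k(i := k i - 1))(i := (k(i := k i - 1)) i + 1) = k" if "k \<in> ?A" for k
      using that by simp
  qed simp
  then have "card ?A = card (partitions u (insert i I) (\<beta> - u i))"
    by (rule bij_betw_same_card[symmetric])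
  \<comment> \<open>Families are extensional: outside the index set the value is
    \<open>undefined\<close>, so \<open>i\<close> carries 0 on one side and \<open>undefined\<close>
    on the other.\<close>
  moreover have "bij_betw (\<lambda>k. k(i := 0)) (partitions u I \<beta>) ?B"
  proof (rule bij_betwI[where g = "\<lambda>k. k(i := undefined)"])
    show "(\<lambda>k. k(i := 0)) \<in> partitions u I \<beta> \<rightarrow> ?B"
      by (rule funcsetI) (simp add: mem mem' s_upd ext)
    show "(\<lambda>k. k(i := undefined)) \<in> ?B \<rightarrow> partitions u I \<beta>"
      by (rule funcsetI) (simp add: mem mem' s_upd extensional_def)
    show "(k(i := 0))(i := undefined) = k" if "k \<in> partitions u I \<beta>" for k
      using that i by (simp add: mem' extensional_def fun_upd_idem)
    show "(k(i := undefined))(i := 0) = k" if "k \<in> ?B" for k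
      using that by (simp add: fun_upd_idem)
  qed
  then have "card ?B = card (partitions u I \<beta>)"
    by (rule bij_betw_same_card[symmetric])
  ultimately show ?thesis by simp
qed

text \<open>The partition function is the coefficient function of the product of the geometric
  series in \<open>u i\<close>, the inverse of the product of binomials; \<open>lookup 1\<close> is
  the delta function at 0.\<close>

lemma formal_action_prod_bino_partitions:
  assumes t: "linear t" and "finite I" and "\<And>i. i \<in> I \<Longrightarrow> t (u i) > (0::real)"
  shows "formal_action (\<Prod>i\<in>I. bino (u i)) (\<lambda>\<beta>. int (card (partitions u I \<beta>))) = Poly_Mapping.lookup 1"
  using assms(2,3)
proof (induction I rule: finite_induct)
  case empty
  have "partitions u {} \<beta> = (if \<beta> = 0 then {\<lambda>_. undefined} else {})" for \<beta>
    by (auto simp: partitions_def)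
  then show ?case
    by (auto simp: lookup_one when_def fun_eq_iff)
next
  case (insert i I)
  have "int (card (partitions u (insert i I) \<beta>)) - int (card (partitions u (insert i I) (\<beta> - u i))) =
      int (card (partitions u I \<beta>))" for \<beta>
    using card_partitions_insert[where u = u and \<beta> = \<beta>, OF t insert.hyps(1,2) insert.prems] by simp
  then have "formal_action (bino (u i)) (\<lambda>\<beta>. int (card (partitions u (insert i I) \<beta>))) =
      (\<lambda>\<beta>. int (card (partitions u I \<beta>)))"
    unfolding fun_eq_iff formal_action_bino by blast
  moreover have "(\<Prod>j\<in>insert i I. bino (u j)) = (\<Prod>j\<in>I. bino (u j)) * bino (u i)"
    using insert.hyps by (simp add: mult.commute)
  ultimately show ?case
    using insert.IH insert.prems by (simp only: formal_action_mult) blast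
qed

text \<open>Factors in directions independent of \<open>\<gamma>\<close> are stripped one by one.
  The hypothesis supplies a grading in which \<open>\<gamma>\<close> has degree 0 and
  \<open>u i\<close> does not; if \<open>u i\<close> has negative degree, the opposite grading is
  used.\<close>

lemma bino_dvd_prod_bino_mult:
  fixes \<gamma> :: "'b::ab_group_add"
  assumes "\<And>i. i \<in> I \<Longrightarrow> \<exists>t::'b \<Rightarrow> real. Modules.additive t \<and> t \<gamma> = 0 \<and> t (u i) \<noteq> 0"
    and "bino \<gamma> dvd (\<Prod>i\<in>I. bino (u i)) * P"
  shows "bino \<gamma> dvd P"
  using assms
proof (induction I rule: infinite_finite_induct)
  case (insert i I)
  obtain t :: "'b \<Rightarrow> real" where t: "Modules.additive t" "t \<gamma> = 0" "t (u i) \<noteq> 0"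
    using insert.prems(1)[of i] by blast
  have dvd: "bino \<gamma> dvd bino (u i) * ((\<Prod>i\<in>I. bino (u i)) * P)"
    using insert.prems(2) insert.hyps by (simp add: mult.assoc)
  have "bino \<gamma> dvd (\<Prod>i\<in>I. bino (u i)) * P"
  proof (cases "t (u i) > 0")
    case True
    then show ?thesis
      using bino_dvd_bino_mult[OF t(1,2) _ dvd] by blast
  next
    case False
    then have "Modules.additive (\<lambda>x. - t x)" "- t \<gamma> = 0" "- t (u i) > 0"
      using t by (auto simp: Modules.additive_def)
    then show ?thesis
      using bino_dvd_bino_mult[OF _ _ _ dvd, of "\<lambda>x. - t x"] by blast
  qed
  then show ?case
    using insert.IH insert.prems(1) by blast
qed auto

text \<open>A finitely supported series is bounded below for \<open>t\<close>, so the uniqueness of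
  expansions makes such a product a non-zero-divisor.\<close>

lemma prod_bino_mult_eq_0:
  fixes t :: "'b::ab_group_add \<Rightarrow> real"
  assumes t: "Modules.additive t" and "\<And>i. i \<in> I \<Longrightarrow> t (u i) \<noteq> 0"
    and "(\<Prod>i\<in>I. bino (u i)) * P = 0"
  shows "P = 0"
proof (cases "finite I")
  case True
  have "Poly_Mapping.lookup P \<beta> = 0" for \<beta>
  proof (rule formal_action_prod_bino_eq_0[OF t True assms(2)])
    show "formal_action (\<Prod>i\<in>I. bino (u i)) (Poly_Mapping.lookup P) \<beta> = 0" for \<beta>
      by (simp add: formal_action_lookup assms(3))
    show "Min (t ` Poly_Mapping.keys P) \<le> t \<beta>" if "Poly_Mapping.lookup P \<beta> \<noteq> 0" for \<beta>
      using that by (intro Min_le) (auto simp: in_keys_iff)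
  qed
  then show ?thesis
    by (intro poly_mapping_eqI) simp
qed (use assms(3) in simp)

section \<open>Characters\<close>

text \<open>Dedekind's argument: subtracting \<open>u k y\<close> times the relation at
  \<open>x\<close> from the relation at \<open>y + x\<close> removes the term of \<open>k\<close>
  and leaves a shorter relation with coefficients \<open>c i * (u i y - u k y)\<close>.\<close>

lemma characters_independent:
  fixes u :: "'i \<Rightarrow> 'x::semigroup_add \<Rightarrow> 'c::field"
  assumes "finite I"
    and add: "\<And>x y. x \<in> Y \<Longrightarrow> y \<in> Y \<Longrightarrow> x + y \<in> Y"
    and mult: "\<And>i x y. i \<in> I \<Longrightarrow> x \<in> Y \<Longrightarrow> y \<in> Y \<Longrightarrow> u i (x + y) = u i x * u i y"
    and nz: "\<And>i. i \<in> I \<Longrightarrow> \<exists>x\<in>Y. u i x \<noteq> 0"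
    and dist: "\<And>i j. i \<in> I \<Longrightarrow> j \<in> I \<Longrightarrow> i \<noteq> j \<Longrightarrow> \<exists>x\<in>Y. u i x \<noteq> u j x"
    and eq: "\<And>x. x \<in> Y \<Longrightarrow> (\<Sum>i\<in>I. c i * u i x) = 0"
  shows "\<forall>i\<in>I. c i = 0"
  using assms(1) mult nz dist eq
proof (induction I arbitrary: c rule: finite_induct)
  case (insert k I)
  have eq0: "c k * u k x + (\<Sum>i\<in>I. c i * u i x) = 0" if "x \<in> Y" for x
    using insert.prems(4)[OF that] insert.hyps by simp
  have "\<forall>i\<in>I. c i * (u i y - u k y) = 0" if y: "y \<in> Y" for y
  proof (rule insert.IH)
    fix x assume x: "x \<in> Y"
    have "(\<Sum>i\<in>I. c i * (u i y - u k y) * u i x) =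
        (\<Sum>i\<in>I. c i * u i (y + x)) - u k y * (\<Sum>i\<in>I. c i * u i x)"
      using x y insert.prems(1)
      by (simp add: sum_distrib_left sum_subtractf[symmetric] algebra_simps)
    also have "\<dots> = - c k * u k (y + x) + u k y * (c k * u k x)"
      using eq0[OF x] eq0[OF add[OF y x]] by (simp add: add_eq_0_iff)
    also have "\<dots> = 0"
      using x y insert.prems(1) by simp
    finally show "(\<Sum>i\<in>I. c i * (u i y - u k y) * u i x) = 0" .
  qed (use insert.prems in auto)
  then have I: "\<forall>i\<in>I. c i = 0"
    using insert.prems(3) insert.hyps by (metis eq_iff_diff_eq_0 insertCI mult_eq_0_iff)
  moreover have "c k = 0"
    using insert.prems(2)[of k] eq0 I by auto
  ultimately show ?case by simp
qed simp

text \<open>A representation that is a sum of characters determines them with multiplicity. Grouping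
  indices by their restriction to \<open>Y\<close>, the differences of multiplicities form a
  relation among distinct characters, hence vanish; characteristic 0 recovers the natural
  numbers.\<close>

lemma image_mset_eq_of_sum_characters_eq:
  fixes u :: "'i \<Rightarrow> 'x::semigroup_add \<Rightarrow> 'c::field_char_0"
  assumes fin: "finite A" "finite B"
    and add: "\<And>x y. x \<in> Y \<Longrightarrow> y \<in> Y \<Longrightarrow> x + y \<in> Y"
    and mult: "\<And>i x y. x \<in> Y \<Longrightarrow> y \<in> Y \<Longrightarrow> u i (x + y) = u i x * u i y"
    and nz: "\<And>i. \<exists>x\<in>Y. u i x \<noteq> 0"
    and eq: "\<And>x. x \<in> Y \<Longrightarrow> (\<Sum>i\<in>A. u i x) = (\<Sum>i\<in>B. u i x)"
  shows "image_mset (\<lambda>i. restrict (u i) Y) (mset_set A) = image_mset (\<lambda>i. restrict (u i) Y) (mset_set B)"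
proof -
  define h where "h i = restrict (u i) Y" for i
  define S where "S = h ` (A \<union> B)"
  have count: "count (image_mset h (mset_set C)) \<phi> = card {i \<in> C. h i = \<phi>}" if "finite C" for C \<phi>
    using that by (auto simp: count_image_mset Int_def vimage_def conj_commute)
  have split: "(\<Sum>i\<in>C. u i x) = (\<Sum>\<phi>\<in>S. of_nat (card {i \<in> C. h i = \<phi>}) * \<phi> x)"
    if C: "finite C" "C \<subseteq> A \<union> B" and x: "x \<in> Y" for C x
  proof -
    have "(\<Sum>i\<in>C. u i x) = (\<Sum>\<phi>\<in>S. \<Sum>i\<in>{i \<in> C. h i = \<phi>}. u i x)"
      by (rule sum.group[symmetric]) (use C fin in \<open>auto simp: S_def\<close>)
    also have "\<dots> = (\<Sum>\<phi>\<in>S. \<Sum>i\<in>{i \<in> C. h i = \<phi>}. \<phi> x)"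
      by (intro sum.cong) (use x in \<open>auto simp: h_def\<close>)
    finally show ?thesis by simp
  qed
  define c :: "('x \<Rightarrow> 'c) \<Rightarrow> 'c"
    where "c \<phi> = of_nat (card {i \<in> A. h i = \<phi>}) - of_nat (card {i \<in> B. h i = \<phi>})" for \<phi>
  have c0: "\<forall>\<phi>\<in>S. c \<phi> = 0"
  proof (rule characters_independent[where u = "\<lambda>\<phi>. \<phi>" and Y = Y])
    show "\<exists>x\<in>Y. \<phi> x \<noteq> \<psi> x" if "\<phi> \<in> S" "\<psi> \<in> S" "\<phi> \<noteq> \<psi>" for \<phi> \<psi>
      using that extensionalityI[of \<phi> Y \<psi>] by (auto simp: S_def h_def)
    show "\<exists>x\<in>Y. \<phi> x \<noteq> 0" if "\<phi> \<in> S" for \<phi>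
      using that nz by (fastforce simp: S_def h_def)
    show "(\<Sum>\<phi>\<in>S. c \<phi> * \<phi> x) = 0" if "x \<in> Y" for x
      using eq[OF that] split[OF fin(1) _ that] split[OF fin(2) _ that]
      by (simp add: c_def left_diff_distrib sum_subtractf)
  qed (use fin add mult in \<open>auto simp: S_def h_def\<close>)
  have "card {i \<in> A. h i = \<phi>} = card {i \<in> B. h i = \<phi>}" for \<phi>
  proof (cases "\<phi> \<in> S")
    case False
    then have "{i \<in> A. h i = \<phi>} = {}" "{i \<in> B. h i = \<phi>} = {}"
      by (auto simp: S_def)
    then show ?thesis by (simp only:)
  qed (use c0 in \<open>simp add: c_def\<close>)
  then have "image_mset h (mset_set A) = image_mset h (mset_set B)"
    by (intro multiset_eqI) (simp add: count fin)
  then show ?thesis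
    unfolding h_def .
qed

text \<open>The equal images match the factors in pairs congruent modulo \<open>k\<close>; they are
  exchanged one pair at a time.\<close>

lemma dvd_prod_mset_diff:
  fixes k :: "'c::comm_ring_1"
  assumes "\<And>x y. h x = h y \<Longrightarrow> k dvd g x - g y"
    and "image_mset h M = image_mset h N"
  shows "k dvd (\<Prod>x\<in>#M. g x) - (\<Prod>x\<in>#N. g x)"
  using assms(2)
proof (induction M arbitrary: N)
  case (add x M)
  then obtain y N' where N: "N = add_mset y N'" "h y = h x" "image_mset h N' = image_mset h M"
    by (metis image_mset_add_mset msed_map_invR)
  then have "k dvd (\<Prod>x\<in>#M. g x) - (\<Prod>x\<in>#N'. g x)" "k dvd g x - g y"
    using add.IH[of N'] assms(1)[of x y] by auto
  then have "k dvd g x * ((\<Prod>x\<in>#M. g x) - (\<Prod>x\<in>#N'. g x)) + (g x - g y) * (\<Prod>x\<in>#N'. g x)"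
    by simp
  also have "\<dots> = (\<Prod>x\<in>#add_mset x M. g x) - (\<Prod>x\<in>#N. g x)"
    by (simp add: N(1) algebra_simps)
  finally show ?case .
qed simp

section \<open>Linear functionals and integrality\<close>

lemma blinfun_eq_scaleR_of_kernel_subset:
  fixes \<gamma> \<delta> :: "'g::real_normed_vector \<Rightarrow>\<^sub>L real"
  assumes "\<And>x. blinfun_apply \<gamma> x = 0 \<Longrightarrow> blinfun_apply \<delta> x = 0"
  obtains c where "\<delta> = c *\<^sub>R \<gamma>"
proof (cases "\<gamma> = 0")
  case True
  then have "\<delta> = 0 *\<^sub>R \<gamma>"
    using assms by (auto intro: blinfun_eqI)
  then show ?thesis using that by blast
next
  case False
  then obtain v where v: "blinfun_apply \<gamma> v \<noteq> 0"
    by (metis blinfun_eqI zero_blinfun.rep_eq)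
  have "\<delta> = (blinfun_apply \<delta> v / blinfun_apply \<gamma> v) *\<^sub>R \<gamma>"
  proof (rule blinfun_eqI)
    fix x
    have "blinfun_apply \<delta> (x - (blinfun_apply \<gamma> x / blinfun_apply \<gamma> v) *\<^sub>R v) = 0"
      by (rule assms) (use v in \<open>simp add: blinfun.diff_right blinfun.scaleR_right\<close>)
    then show "blinfun_apply \<delta> x =
        blinfun_apply ((blinfun_apply \<delta> v / blinfun_apply \<gamma> v) *\<^sub>R \<gamma>) x"
      by (simp add: blinfun.diff_right blinfun.scaleR_right blinfun.scaleR_left)
  qed
  then show ?thesis using that by blast
qed

text \<open>A nonzero value could be rescaled to one half.\<close>

lemma blinfun_eq_0_of_int_on_line:
  fixes \<delta> :: "'g::real_normed_vector \<Rightarrow>\<^sub>L real"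
  assumes "\<And>s. blinfun_apply \<delta> (s *\<^sub>R x) \<in> \<int>"
  shows "blinfun_apply \<delta> x = 0"
proof (rule ccontr)
  assume "blinfun_apply \<delta> x \<noteq> 0"
  then have "(1 / 2 :: real) \<in> \<int>"
    using assms[of "1 / (2 * blinfun_apply \<delta> x)"] by (simp add: blinfun.scaleR_right)
  then show False by (auto elim!: Ints_cases)
qed

text \<open>On the kernel of \<open>\<gamma>\<close> all multiples of a vector have integral values
  under \<open>\<delta>\<close>, so \<open>\<delta>\<close> vanishes there and equals
  \<open>c *\<^sub>R \<gamma>\<close>. A vector on which \<open>\<gamma>\<close> is 1 shows that
  \<open>c\<close> is an integer.\<close>

lemma blinfun_eq_int_multiple:
  fixes \<gamma> \<delta> :: "'g::real_normed_vector \<Rightarrow>\<^sub>L real"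
  assumes "\<gamma> \<noteq> 0" and int: "\<And>x. blinfun_apply \<gamma> x \<in> \<int> \<Longrightarrow> blinfun_apply \<delta> x \<in> \<int>"
  obtains m :: int where "\<delta> = of_int m *\<^sub>R \<gamma>"
proof -
  have "blinfun_apply \<delta> x = 0" if "blinfun_apply \<gamma> x = 0" for x
    by (rule blinfun_eq_0_of_int_on_line, rule int) (simp add: that blinfun.scaleR_right)
  then obtain c where c: "\<delta> = c *\<^sub>R \<gamma>"
    using blinfun_eq_scaleR_of_kernel_subset by blast
  obtain v where v: "blinfun_apply \<gamma> v \<noteq> 0"
    using assms(1) by (metis blinfun_eqI zero_blinfun.rep_eq)
  have "c \<in> \<int>"
    using int[of "(1 / blinfun_apply \<gamma> v) *\<^sub>R v"] v
    by (simp add: c blinfun.scaleR_right blinfun.scaleR_left)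
  then show ?thesis
    using that c by (auto elim: Ints_cases)
qed

text \<open>The character pulled back to the Lie algebra. It avoids the choice of a preimage under
  the exponential map and makes sense for every functional.\<close>

definition weight_exp :: "('g::real_normed_vector \<Rightarrow>\<^sub>L real) \<Rightarrow> 'g \<Rightarrow> complex" where
  "weight_exp \<beta> x = cis (2 * pi * blinfun_apply \<beta> x)"

lemma weight_exp_add: "weight_exp (\<beta> + \<gamma>) x = weight_exp \<beta> x * weight_exp \<gamma> x"
  and weight_exp_add_right: "weight_exp \<beta> (x + y) = weight_exp \<beta> x * weight_exp \<beta> y"
  by (simp_all add: weight_exp_def blinfun.add_left blinfun.add_right distrib_left cis_mult)

lemma weight_exp_0 [simp]: "weight_exp 0 x = 1"
  by (simp add: weight_exp_def)

lemma norm_weight_exp [simp]: "norm (weight_exp \<beta> x) = 1"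
  by (simp add: weight_exp_def)

lemma weight_exp_nonzero [simp]: "weight_exp \<beta> x \<noteq> 0"
  by (simp add: weight_exp_def)

lemma weight_exp_eq_1_iff: "weight_exp \<beta> x = 1 \<longleftrightarrow> blinfun_apply \<beta> x \<in> \<int>"
proof
  assume "weight_exp \<beta> x = 1"
  then have "cos (2 * pi * blinfun_apply \<beta> x) = 1"
    by (simp add: weight_exp_def complex_eq_iff)
  then obtain m :: int where "2 * pi * blinfun_apply \<beta> x = of_int m * 2 * pi"
    by (auto simp: cos_one_2pi_int)
  then have "blinfun_apply \<beta> x = of_int m" by simp
  then show "blinfun_apply \<beta> x \<in> \<int>" by simp
qed (simp add: weight_exp_def cis_multiple_2pi)

lemma weight_exp_eq_iff: "weight_exp \<beta> x = weight_exp \<gamma> x \<longleftrightarrow> blinfun_apply (\<beta> - \<gamma>) x \<in> \<int>"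
proof -
  have "weight_exp \<beta> x = weight_exp (\<beta> - \<gamma>) x * weight_exp \<gamma> x"
    by (simp flip: weight_exp_add)
  then show ?thesis
    by (auto simp flip: weight_exp_eq_1_iff)
qed

lemma eq_of_weight_exp_eq:
  assumes "\<And>x. weight_exp \<beta> x = weight_exp \<gamma> x"
  shows "\<beta> = \<gamma>"
proof -
  have "blinfun_apply (\<beta> - \<gamma>) x = 0" for x
    by (rule blinfun_eq_0_of_int_on_line) (use assms weight_exp_eq_iff in blast)
  then show ?thesis
    by (auto intro!: blinfun_eqI simp: blinfun.diff_left)
qed

lemma sum_weight_exp_independent:
  fixes c :: "('g::real_normed_vector \<Rightarrow>\<^sub>L real) \<Rightarrow> complex"
  assumes "finite I" "\<And>x. (\<Sum>\<beta>\<in>I. c \<beta> * weight_exp \<beta> x) = 0"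
  shows "\<forall>\<beta>\<in>I. c \<beta> = 0"
proof (rule characters_independent[where u = weight_exp and Y = UNIV])
  show "\<exists>x\<in>UNIV. weight_exp \<beta> x \<noteq> weight_exp \<gamma> x" if "\<beta> \<noteq> \<gamma>" for \<beta> \<gamma> :: "'g \<Rightarrow>\<^sub>L real"
    using that eq_of_weight_exp_eq by blast
qed (use assms in \<open>auto simp: weight_exp_add_right\<close>)

lemma continuous_weight_exp: "continuous_on S (weight_exp \<beta>)"
  unfolding weight_exp_def by (intro continuous_intros)

section \<open>Closure properties of the weight lattice\<close>

lemma weight_lattice_add: "\<beta> \<in> weight_lattice G \<Longrightarrow> \<gamma> \<in> weight_lattice G \<Longrightarrow> \<beta> + \<gamma> \<in> weight_lattice G"
  and weight_lattice_scale: "\<beta> \<in> weight_lattice G \<Longrightarrow> real k *\<^sub>R \<beta> \<in> weight_lattice G"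
  and weight_lattice_0: "0 \<in> weight_lattice G"
  by (auto simp: weight_lattice_def blinfun.add_left blinfun.scaleR_left)

lemma weight_lattice_sum: "(\<And>i. i \<in> I \<Longrightarrow> u i \<in> weight_lattice G) \<Longrightarrow> (\<Sum>i\<in>I. u i) \<in> weight_lattice G"
  by (induction I rule: infinite_finite_induct) (auto intro: weight_lattice_add weight_lattice_0)

section \<open>Tori\<close>

context torus
begin

lemma gexp_in_carrier [simp]: "gexp G x \<in> carrier G"
  using range_gexp by blast

lemma gexp_0: "gexp G 0 = \<one>"
  using gexp_add[of 0 0] by (simp only: add_0 l_cancel_one' gexp_in_carrier)

lemma gexp_uminus: "gexp G (- x) = inv (gexp G x)"
  using gexp_add[of "- x" x] by (simp add: gexp_0 inv_equality)

text \<open>The preimage chosen by \<open>inv_into\<close> differs from \<open>x\<close> by an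
  element of the integral lattice, on which \<open>\<beta>\<close> is integral.\<close>

lemma weight_char_gexp:
  assumes "\<beta> \<in> weight_lattice G"
  shows "weight_char G \<beta> (gexp G x) = weight_exp \<beta> x"
proof -
  define y where "y = inv_into UNIV (gexp G) (gexp G x)"
  have "gexp G y = gexp G x"
    unfolding y_def by (simp add: f_inv_into_f)
  moreover have "gexp G y = gexp G (y - x) \<otimes> gexp G x"
    by (simp flip: gexp_add)
  ultimately have "gexp G (y - x) = \<one>"
    by (simp add: r_cancel_one')
  then have "blinfun_apply \<beta> (y - x) \<in> \<int>"
    using assms by (simp add: weight_lattice_def integral_lattice_def)
  then have "weight_exp \<beta> (y - x) = 1"
    by (simp add: weight_exp_eq_1_iff)
  then have "weight_exp \<beta> y = weight_exp \<beta> x"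
    using weight_exp_add_right[of \<beta> "y - x" x] by simp
  then show ?thesis
    by (simp add: weight_char_def weight_exp_def y_def)
qed

lemma carrier_gexpE:
  assumes "g \<in> carrier G" obtains x where "g = gexp G x"
  using assms range_gexp by blast

text \<open>Continuity descends from the Lie algebra because the exponential map, being open,
  continuous and surjective, is a quotient map.\<close>

lemma weight_char_in_characters:
  assumes \<beta>: "\<beta> \<in> weight_lattice G"
  shows "weight_char G \<beta> \<in> characters G (carrier G)"
proof -
  have "quotient_map euclidean (gtop G) (gexp G)"
    using open_gexp continuous_gexp
    by (intro continuous_open_imp_quotient_map) (auto simp: topspace_gtop range_gexp)
  moreover have "weight_char G \<beta> \<circ> gexp G = weight_exp \<beta>"
    using weight_char_gexp[OF \<beta>] by auto
  ultimately have "continuous_map (gtop G) euclidean (weight_char G \<beta>)"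
    using continuous_compose_quotient_map_eq[of euclidean "gtop G" "gexp G" euclidean "weight_char G \<beta>"]
      continuous_weight_exp[of UNIV \<beta>]
    by (simp add: continuous_map_iff_continuous)
  then have "continuous_map (subtopology (gtop G) (carrier G)) euclidean (weight_char G \<beta>)"
    by (rule continuous_map_from_subtopology)
  moreover have "weight_char G \<beta> \<in> hom (G\<lparr>carrier := carrier G\<rparr>) circle_group"
  proof (rule homI)
    show "weight_char G \<beta> x \<in> carrier circle_group" if "x \<in> carrier (G\<lparr>carrier := carrier G\<rparr>)" for x
    proof -
      have "x \<in> carrier G"
        using that by simp
      then obtain v where "x = gexp G v"
        by (rule carrier_gexpE)
      then show ?thesis
        by (simp add: weight_char_gexp[OF \<beta>] circle_group_def)
    qed
    show "weight_char G \<beta> (x \<otimes>\<^bsub>G\<lparr>carrier := carrier G\<rparr>\<^esub> y) =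
        weight_char G \<beta> x \<otimes>\<^bsub>circle_group\<^esub> weight_char G \<beta> y"
      if "x \<in> carrier (G\<lparr>carrier := carrier G\<rparr>)" "y \<in> carrier (G\<lparr>carrier := carrier G\<rparr>)" for x y
    proof -
      have "x \<in> carrier G" "y \<in> carrier G"
        using that by simp_all
      then obtain v w where "x = gexp G v" "y = gexp G w"
        using carrier_gexpE by metis
      then show ?thesis
        by (simp add: weight_char_gexp[OF \<beta>] weight_exp_add_right circle_group_def flip: gexp_add)
    qed
  qed
  ultimately show ?thesis
    by (simp add: characters_def weight_char_def)
qed

lemma inj_on_weight_char: "inj_on (weight_char G) (weight_lattice G)"
proof (rule inj_onI)
  fix \<beta> \<gamma>
  assume "\<beta> \<in> weight_lattice G" "\<gamma> \<in> weight_lattice G" and eq: "weight_char G \<beta> = weight_char G \<gamma>"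
  then have "weight_exp \<beta> x = weight_exp \<gamma> x" for x
    by (simp flip: weight_char_gexp)
  then show "\<beta> = \<gamma>"
    by (rule eq_of_weight_exp_eq)
qed

section \<open>Elements of the character ring and their multiplicities\<close>

lemma character_ring_continuous:
  assumes "\<phi> \<in> character_ring G (carrier G)"
  shows "continuous_on UNIV (\<lambda>x. \<phi> (gexp G x))"
proof -
  obtain S m where S: "finite S" "S \<subseteq> characters G (carrier G)"
    and eq: "\<forall>h\<in>carrier G. \<phi> h = (\<Sum>\<psi>\<in>S. of_int (m \<psi>) * \<psi> h)"
    using assms unfolding character_ring_def by blast
  have "continuous_on UNIV (\<lambda>x. \<psi> (gexp G x))" if "\<psi> \<in> S" for \<psi>
  proof -
    have "continuous_map (gtop G) euclidean \<psi>"
      using that S(2) by (auto simp: characters_def subtopology_superset topspace_gtop)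
    then have "continuous_map euclidean euclidean (\<psi> \<circ> gexp G)"
      using continuous_gexp continuous_map_compose by blast
    then show ?thesis
      by (simp add: continuous_map_iff_continuous o_def)
  qed
  then have "continuous_on UNIV (\<lambda>x. \<Sum>\<psi>\<in>S. of_int (m \<psi>) * \<psi> (gexp G x))"
    by (intro continuous_intros) auto
  then show ?thesis
    using eq by simp
qed

lemma lin_ext_in_character_ring:
  fixes M :: "('g \<Rightarrow>\<^sub>L real) \<Rightarrow>\<^sub>0 int"
  assumes M: "Poly_Mapping.keys M \<subseteq> weight_lattice G"
  shows "(\<lambda>g\<in>carrier G. lin_ext (\<lambda>\<beta>. weight_char G \<beta> g) M) \<in> character_ring G (carrier G)"
proof -
  have inj: "inj_on (weight_char G) (Poly_Mapping.keys M)"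
    using inj_on_weight_char M inj_on_subset by blast
  \<comment> \<open>\<open>character_ring\<close> indexes coefficients by characters and
    \<open>M\<close> by weights; injectivity of \<open>weight_char\<close> on the weight lattice
    allows passing from one to the other.\<close>
  define m where "m \<psi> = Poly_Mapping.lookup M (inv_into (Poly_Mapping.keys M) (weight_char G) \<psi>)" for \<psi>
  have "lin_ext (\<lambda>\<beta>. weight_char G \<beta> g) M = (\<Sum>\<psi>\<in>weight_char G ` Poly_Mapping.keys M. of_int (m \<psi>) * \<psi> g)" for g
    using inj by (simp add: sum.reindex lin_ext_def m_def)
  moreover have "weight_char G ` Poly_Mapping.keys M \<subseteq> characters G (carrier G)"
    using M weight_char_in_characters by blast
  ultimately show ?thesis
    unfolding character_ring_def
    by (auto intro!: exI[of _ "weight_char G ` Poly_Mapping.keys M"] exI[of _ m])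
qed

text \<open>Any other admissible coefficient function gives, on the union of both supports, a linear
  relation among distinct exponentials, so the description is met by \<open>lookup M\<close>
  alone.\<close>

lemma weight_multiplicity_lin:
  fixes M :: "('g \<Rightarrow>\<^sub>L real) \<Rightarrow>\<^sub>0 int"
  assumes M: "Poly_Mapping.keys M \<subseteq> weight_lattice G"
  shows "weight_multiplicity G (\<lambda>g\<in>carrier G. lin_ext (\<lambda>\<beta>. weight_char G \<beta> g) M) = Poly_Mapping.lookup M"
  unfolding weight_multiplicity_def
proof (rule the_equality)
  have keys: "{\<beta>. Poly_Mapping.lookup M \<beta> \<noteq> 0} = Poly_Mapping.keys M"
    by (auto simp: in_keys_iff)
  show "finite {\<beta>. Poly_Mapping.lookup M \<beta> \<noteq> 0} \<and>
    {\<beta>. Poly_Mapping.lookup M \<beta> \<noteq> 0} \<subseteq> weight_lattice G \<and>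
    (\<forall>g\<in>carrier G. (\<lambda>g\<in>carrier G. lin_ext (\<lambda>\<beta>. weight_char G \<beta> g) M) g =
      (\<Sum>\<beta> | Poly_Mapping.lookup M \<beta> \<noteq> 0. of_int (Poly_Mapping.lookup M \<beta>) * weight_char G \<beta> g))"
    using M unfolding keys by (simp add: lin_ext_def)
  fix m :: "('g \<Rightarrow>\<^sub>L real) \<Rightarrow> int"
  assume m: "finite {\<beta>. m \<beta> \<noteq> 0} \<and> {\<beta>. m \<beta> \<noteq> 0} \<subseteq> weight_lattice G \<and>
    (\<forall>g\<in>carrier G. (\<lambda>g\<in>carrier G. lin_ext (\<lambda>\<beta>. weight_char G \<beta> g) M) g =
      (\<Sum>\<beta> | m \<beta> \<noteq> 0. of_int (m \<beta>) * weight_char G \<beta> g))"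
  define I where "I = {\<beta>. m \<beta> \<noteq> 0} \<union> Poly_Mapping.keys M"
  have I: "finite I" "I \<subseteq> weight_lattice G"
    using m M by (auto simp: I_def)
  have "(\<Sum>\<beta>\<in>I. of_int (m \<beta> - Poly_Mapping.lookup M \<beta>) * weight_exp \<beta> x) = 0" for x
  proof -
    have "(\<Sum>\<beta>\<in>I. of_int (m \<beta>) * weight_char G \<beta> (gexp G x)) =
        (\<Sum>\<beta> | m \<beta> \<noteq> 0. of_int (m \<beta>) * weight_char G \<beta> (gexp G x))"
      using I by (intro sum.mono_neutral_right) (auto simp: I_def)
    also have "\<dots> = lin_ext (\<lambda>\<beta>. weight_char G \<beta> (gexp G x)) M"
      using m by simp
    also have "\<dots> = (\<Sum>\<beta>\<in>I. of_int (Poly_Mapping.lookup M \<beta>) * weight_char G \<beta> (gexp G x))"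
      using I by (intro lin_ext_superset) (auto simp: I_def)
    finally have "(\<Sum>\<beta>\<in>I. of_int (m \<beta> - Poly_Mapping.lookup M \<beta>) * weight_char G \<beta> (gexp G x)) = 0"
      by (simp add: left_diff_distrib sum_subtractf)
    moreover have "(\<Sum>\<beta>\<in>I. of_int (m \<beta> - Poly_Mapping.lookup M \<beta>) * weight_char G \<beta> (gexp G x)) =
        (\<Sum>\<beta>\<in>I. of_int (m \<beta> - Poly_Mapping.lookup M \<beta>) * weight_exp \<beta> x)"
      using I(2) weight_char_gexp by (intro sum.cong) auto
    ultimately show ?thesis by simp
  qed
  then have "\<forall>\<beta>\<in>I. complex_of_int (m \<beta> - Poly_Mapping.lookup M \<beta>) = 0"
    using I(1) by (intro sum_weight_exp_independent)
  then have "m \<beta> = Poly_Mapping.lookup M \<beta>" if "\<beta> \<in> I" for \<beta>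
    using that by (metis eq_iff_diff_eq_0 of_int_eq_0_iff)
  moreover have "m \<beta> = Poly_Mapping.lookup M \<beta>" if "\<beta> \<notin> I" for \<beta>
    using that by (simp add: I_def in_keys_iff)
  ultimately show "m = Poly_Mapping.lookup M"
    by blast
qed

text \<open>Regular elements are dense: \<open>exp (x + s \<xi>)\<close> is regular for all small \<open>s \<noteq> 0\<close>.\<close>
lemma character_ring_eqI:
  assumes \<phi>: "\<phi> \<in> character_ring G (carrier G)" "\<psi> \<in> character_ring G (carrier G)"
    and fin: "finite A" and A: "A \<subseteq> weight_lattice G" and \<xi>: "\<And>\<beta>. \<beta> \<in> A \<Longrightarrow> blinfun_apply \<beta> \<xi> \<noteq> 0"
    and eq: "\<And>g. g \<in> carrier G \<Longrightarrow> \<forall>\<beta>\<in>A. weight_char G \<beta> g \<noteq> 1 \<Longrightarrow> \<phi> g = \<psi> g"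
  shows "\<phi> = \<psi>"
proof (rule extensionalityI[of _ "carrier G"])
  fix g assume "g \<in> carrier G"
  then obtain x where g: "g = gexp G x" by (rule carrier_gexpE)
  have "\<forall>\<^sub>F s in at 0. weight_exp \<beta> (x + s *\<^sub>R \<xi>) \<noteq> 1" if "\<beta> \<in> A" for \<beta>
  proof -
    have "\<forall>\<^sub>F s in at 0. blinfun_apply \<beta> x + s * blinfun_apply \<beta> \<xi> \<notin> \<int>"
    proof -
      let ?r = "blinfun_apply \<beta> x"
      have "((\<lambda>s. ?r + s * blinfun_apply \<beta> \<xi>) \<longlongrightarrow> ?r) (at 0)"
        by (auto intro!: tendsto_eq_intros)
      \<comment> \<open>The value \<open>?r\<close> at \<open>s = 0\<close> may itself be an
        integer. Removing only the other integers leaves an open neighbourhood of it, and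
        \<open>?r\<close> itself is avoided for \<open>s \<noteq> 0\<close> because
        \<open>\<xi>\<close> is generic.\<close>
      moreover have "open (- (\<int> - {?r}))"
        by (intro open_Compl closed_subset_Ints) auto
      ultimately have "\<forall>\<^sub>F s in at 0. ?r + s * blinfun_apply \<beta> \<xi> \<in> - (\<int> - {?r})"
        by (rule topological_tendstoD) auto
      moreover have "\<forall>\<^sub>F s in at (0::real). s \<noteq> 0"
        by (simp add: eventually_at_filter)
      ultimately show ?thesis
        by eventually_elim (use \<xi>[OF that] in auto)
    qed
    then show ?thesis
      by (simp add: weight_exp_eq_1_iff blinfun.add_right blinfun.scaleR_right)
  qed
  then have "\<forall>\<^sub>F s in at 0. \<forall>\<beta>\<in>A. weight_exp \<beta> (x + s *\<^sub>R \<xi>) \<noteq> 1"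
    using fin by (simp add: eventually_ball_finite)
  then have ev: "\<forall>\<^sub>F s in at 0. \<phi> (gexp G (x + s *\<^sub>R \<xi>)) - \<psi> (gexp G (x + s *\<^sub>R \<xi>)) = 0"
    by eventually_elim (simp add: eq weight_char_gexp subsetD[OF A])
  have "continuous_on UNIV (\<lambda>s. \<phi> (gexp G (x + s *\<^sub>R \<xi>)) - \<psi> (gexp G (x + s *\<^sub>R \<xi>)))"
    by (intro continuous_intros continuous_on_compose2[OF character_ring_continuous[OF \<phi>(1)]]
        continuous_on_compose2[OF character_ring_continuous[OF \<phi>(2)]]) auto
  then have "isCont (\<lambda>s. \<phi> (gexp G (x + s *\<^sub>R \<xi>)) - \<psi> (gexp G (x + s *\<^sub>R \<xi>))) 0"
    by (simp add: continuous_on_eq_continuous_at)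
  then have "((\<lambda>s. \<phi> (gexp G (x + s *\<^sub>R \<xi>)) - \<psi> (gexp G (x + s *\<^sub>R \<xi>))) \<longlongrightarrow> \<phi> g - \<psi> g) (at 0)"
    by (simp add: isCont_def g)
  moreover have "((\<lambda>s. \<phi> (gexp G (x + s *\<^sub>R \<xi>)) - \<psi> (gexp G (x + s *\<^sub>R \<xi>))) \<longlongrightarrow> 0) (at (0::real))"
    using ev by (rule tendsto_eventually)
  ultimately show "\<phi> g = \<psi> g"
    using tendsto_unique[OF at_neq_bot] by fastforce
qed (use \<phi> in \<open>auto simp: character_ring_def\<close>)

end

section \<open>Traces of representations\<close>

lemma sum_diag_mult_commute:
  fixes A B :: "'c::comm_semiring_0 mat"
  assumes "A \<in> carrier_mat k k" "B \<in> carrier_mat k k"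
  shows "(\<Sum>i<k. (A * B) $$ (i, i)) = (\<Sum>i<k. (B * A) $$ (i, i))"
proof -
  have "(\<Sum>i<k. (A * B) $$ (i, i)) = (\<Sum>i<k. \<Sum>j<k. A $$ (i, j) * B $$ (j, i))"
    using assms by (intro sum.cong) (auto simp: scalar_prod_def atLeast0LessThan)
  also have "\<dots> = (\<Sum>j<k. \<Sum>i<k. B $$ (j, i) * A $$ (i, j))"
    by (subst sum.swap) (simp add: mult.commute)
  also have "\<dots> = (\<Sum>j<k. (B * A) $$ (j, j))"
    using assms by (intro sum.cong) (auto simp: scalar_prod_def atLeast0LessThan)
  finally show ?thesis .
qed

lemma rep_character_eq_of_equivalent_reps:
  assumes eqv: "equivalent_reps H k \<rho> \<sigma>" and h: "h \<in> H"
    and car: "\<rho> h \<in> carrier_mat k k" "\<sigma> h \<in> carrier_mat k k"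
  shows "rep_character k \<rho> h = rep_character k \<sigma> h"
proof -
  obtain P where P: "P \<in> Units (ring_mat TYPE(complex) k ())" "P * \<rho> h = \<sigma> h * P"
    using eqv h unfolding equivalent_reps_def by blast
  then obtain Q where Q: "P \<in> carrier_mat k k" "Q \<in> carrier_mat k k" "P * Q = 1\<^sub>m k" "Q * P = 1\<^sub>m k"
    unfolding Units_def ring_mat_simps by blast
  have "\<rho> h = Q * P * \<rho> h"
    using Q car by simp
  also have "\<dots> = Q * (\<sigma> h * P)"
    using Q car P(2) by (metis assoc_mult_mat)
  finally have "rep_character k \<rho> h = (\<Sum>i<k. (Q * (\<sigma> h * P)) $$ (i, i))"
    by (simp add: rep_character_def)
  also have "\<dots> = (\<Sum>i<k. (\<sigma> h * P * Q) $$ (i, i))"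
    using Q car by (intro sum_diag_mult_commute) auto
  also have "\<sigma> h * P * Q = \<sigma> h * (P * Q)"
    using Q car by (intro assoc_mult_mat) auto
  also have "\<dots> = \<sigma> h"
    using Q car by simp
  finally show ?thesis
    by (simp add: rep_character_def)
qed

lemma diag_block_mat_one_by_one:
  fixes As :: "'c::comm_monoid_add mat list"
  assumes "\<And>A. A \<in> set As \<Longrightarrow> A \<in> carrier_mat 1 1"
  shows "diag_block_mat As \<in> carrier_mat (length As) (length As) \<and>
    (\<Sum>i<length As. diag_block_mat As $$ (i, i)) = (\<Sum>A\<leftarrow>As. A $$ (0, 0))"
  using assms
proof (induction As)
  case (Cons A As)
  then have A: "A \<in> carrier_mat 1 1"
    and IH: "diag_block_mat As \<in> carrier_mat (length As) (length As)"
      "(\<Sum>i<length As. diag_block_mat As $$ (i, i)) = (\<Sum>A\<leftarrow>As. A $$ (0, 0))"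
    by auto
  then show ?case
    by (auto simp: Let_def sum.lessThan_Suc_shift simp del: sum.lessThan_Suc)
qed auto

section \<open>Localization on GKM graphs\<close>

locale localization_data = GKM_action G n \<Gamma> arev d \<alpha> \<rho> \<tau>
  for G :: "('a, 'g::euclidean_space, 'm) lie_group_scheme" (structure) and n :: nat
    and \<Gamma> :: "('v, 'e) pre_digraph" and arev :: "'e \<Rightarrow> 'e" and d :: nat
    and \<alpha> :: "'e \<Rightarrow> 'g \<Rightarrow>\<^sub>L real"
    and \<rho> :: "'e \<Rightarrow> 'a \<Rightarrow> complex mat"
    and \<tau> :: "'v \<Rightarrow> 'a \<Rightarrow> complex mat" +
  fixes a :: "'v \<Rightarrow> 'g \<Rightarrow>\<^sub>L real" and \<xi> :: 'g
  assumes generic: "\<And>e. e \<in> arcs \<Gamma> \<Longrightarrow> blinfun_apply (\<alpha> e) \<xi> \<noteq> 0"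
    and vertex_weight: "\<And>p. p \<in> verts \<Gamma> \<Longrightarrow> a p \<in> weight_lattice G"
    and moment: "\<And>e. e \<in> arcs \<Gamma> \<Longrightarrow> \<exists>m::int. a (head \<Gamma> e) - a (tail \<Gamma> e) = of_int m *\<^sub>R \<alpha> e"
begin

section \<open>Weights read off from the representations\<close>

lemma weight_nonzero: "e \<in> arcs \<Gamma> \<Longrightarrow> \<alpha> e \<noteq> 0"
  using generic by force

lemma edge_rep_carrier:
  assumes "e \<in> arcs \<Gamma>" "g \<in> carrier G"
  shows "\<rho> e g \<in> carrier_mat 1 1" "\<rho> e g $$ (0, 0) = weight_char G (\<alpha> e) g"
proof -
  have "\<rho> e g \<in> carrier (units_of (ring_mat TYPE(complex) 1 ()))"
    using edge_rep[OF assms(1)] assms(2) unfolding representation_def by (auto simp: hom_def)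
  then show "\<rho> e g \<in> carrier_mat 1 1"
    by (simp add: units_of_def Units_def ring_mat_simps)
  show "\<rho> e g $$ (0, 0) = weight_char G (\<alpha> e) g"
    using edge_char[OF assms] by (simp add: rep_character_def)
qed

text \<open>Equivalent representations have equal traces, and the trace of a direct sum of
  one-dimensional blocks is the sum of their entries; valency makes the number of blocks equal to
  \<open>d\<close>.\<close>

lemma vertex_character:
  assumes p: "p \<in> verts \<Gamma>" and g: "g \<in> carrier G"
  shows "\<tau> p g \<in> carrier_mat d d"
    and "rep_character d (\<tau> p) g = (\<Sum>e\<in>out_arcs \<Gamma> p. weight_char G (\<alpha> e) g)"
proof -
  have "\<tau> p g \<in> carrier (units_of (ring_mat TYPE(complex) d ()))"
    using vertex_rep[OF p] g unfolding representation_def by (auto simp: hom_def)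
  then show \<tau>: "\<tau> p g \<in> carrier_mat d d"
    by (simp add: units_of_def Units_def ring_mat_simps)
  obtain es where es: "distinct es" "set es = out_arcs \<Gamma> p"
    and eqv: "equivalent_reps (carrier G) d (\<tau> p) (direct_sum_rep \<rho> es)"
    using vertex_rep_sum[OF p] by blast
  have len: "length es = d"
    using es valency[OF p] by (metis distinct_card out_degree_def)
  have car: "A \<in> carrier_mat 1 1" if "A \<in> set (map (\<lambda>e. \<rho> e g) es)" for A
    using that es(2) edge_rep_carrier(1) g by auto
  note diag = diag_block_mat_one_by_one[of "map (\<lambda>e. \<rho> e g) es", OF car]
  have dsum: "direct_sum_rep \<rho> es g \<in> carrier_mat d d"
    using diag len unfolding direct_sum_rep_def by simp
  have "rep_character d (\<tau> p) g = rep_character d (direct_sum_rep \<rho> es) g"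
    by (rule rep_character_eq_of_equivalent_reps[OF eqv g \<tau> dsum])
  also have "\<dots> = (\<Sum>e\<leftarrow>es. \<rho> e g $$ (0, 0))"
    using diag len unfolding rep_character_def direct_sum_rep_def by (simp add: o_def)
  also have "\<dots> = (\<Sum>e\<in>out_arcs \<Gamma> p. \<rho> e g $$ (0, 0))"
    using es by (metis sum_list_distinct_conv_sum_set)
  also have "\<dots> = (\<Sum>e\<in>out_arcs \<Gamma> p. weight_char G (\<alpha> e) g)"
    using edge_rep_carrier(2) g by (intro sum.cong) auto
  finally show "rep_character d (\<tau> p) g = (\<Sum>e\<in>out_arcs \<Gamma> p. weight_char G (\<alpha> e) g)" .
qed

text \<open>The trace of the dual representation at an element is the trace of
  \<open>\<rho> e\<close> at its inverse, and a functional is determined by its exponential.\<close>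

lemma weight_arev: "\<alpha> (arev e) = - \<alpha> e" if e: "e \<in> arcs \<Gamma>"
proof (rule eq_of_weight_exp_eq)
  fix x
  let ?g = "gexp G x"
  have inv: "inv ?g = gexp G (- x)"
    by (simp add: gexp_uminus)
  have dual: "dual_rep G (\<rho> e) ?g \<in> carrier_mat 1 1"
    using edge_rep_carrier(1)[OF e] by (simp add: dual_rep_def)
  have "rep_character 1 (\<rho> (arev e)) ?g = rep_character 1 (dual_rep G (\<rho> e)) ?g"
    by (rule rep_character_eq_of_equivalent_reps[OF edge_rep_rev[OF e] _ _ dual])
      (use edge_rep_carrier(1)[of "arev e"] e in auto)
  also have "\<dots> = weight_char G (\<alpha> e) (inv ?g)"
    using edge_rep_carrier[OF e, of "inv ?g"] by (simp add: rep_character_def dual_rep_def)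
  also have "\<dots> = weight_exp (\<alpha> e) (- x)"
    unfolding inv by (rule weight_char_gexp[OF weight[OF e]])
  also have "\<dots> = weight_exp (- \<alpha> e) x"
    by (simp add: weight_exp_def blinfun.minus_left blinfun.minus_right)
  finally show "weight_exp (\<alpha> (arev e)) x = weight_exp (- \<alpha> e) x"
    using edge_char[of "arev e" ?g] e by (simp add: weight_char_gexp weight)
qed

lemma gexp_in_edge_kernel:
  assumes "e \<in> arcs \<Gamma>" "blinfun_apply (\<alpha> e) x \<in> \<int>"
  shows "gexp G x \<in> edge_kernel G \<alpha> e"
  using assms
  by (simp add: edge_kernel_def kernel_def circle_group_def weight_char_gexp weight weight_exp_eq_1_iff)

text \<open>
  Restricted to \<open>{x. \<alpha> e x \<in> \<int>}\<close>, the characters at the two ends of \<open>e\<close> agree as multisets,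
  and two weights restrict to the same character iff they differ by a multiple of \<open>\<alpha> e\<close>.
\<close>
lemma bino_dvd_edge_diff:
  assumes e: "e \<in> arcs \<Gamma>"
  shows "bino (\<alpha> e) dvd (\<Prod>e'\<in>out_arcs \<Gamma> (tail \<Gamma> e) - {e}. bino (\<alpha> e')) -
    (\<Prod>e'\<in>out_arcs \<Gamma> (head \<Gamma> e) - {arev e}. bino (\<alpha> e'))"
proof -
  define Y where "Y = {x. blinfun_apply (\<alpha> e) x \<in> \<int>}"
  define h where "h \<beta> = restrict (weight_exp \<beta>) Y" for \<beta> :: "'g \<Rightarrow>\<^sub>L real"
  let ?A = "out_arcs \<Gamma> (tail \<Gamma> e)" and ?B = "out_arcs \<Gamma> (head \<Gamma> e)"
  have "image_mset (\<lambda>e'. restrict (weight_exp (\<alpha> e')) Y) (mset_set ?A) =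
      image_mset (\<lambda>e'. restrict (weight_exp (\<alpha> e')) Y) (mset_set ?B)"
  proof (rule image_mset_eq_of_sum_characters_eq)
    show "(\<Sum>e'\<in>?A. weight_exp (\<alpha> e') x) = (\<Sum>e'\<in>?B. weight_exp (\<alpha> e') x)" if x: "x \<in> Y" for x
    proof -
      let ?g = "gexp G x"
      have g: "?g \<in> edge_kernel G \<alpha> e"
        using gexp_in_edge_kernel[OF e] x by (simp add: Y_def)
      have "rep_character d (\<tau> (tail \<Gamma> e)) ?g = rep_character d (\<tau> (head \<Gamma> e)) ?g"
        by (rule rep_character_eq_of_equivalent_reps[OF vertex_reps_agree[OF e] g])
          (use e vertex_character(1) in auto)
      then show ?thesis
        using e by (simp add: vertex_character(2) weight_char_gexp weight)
    qed
    show "\<exists>x\<in>Y. weight_exp (\<alpha> e') x \<noteq> 0" for e'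
      by (intro bexI[of _ 0]) (auto simp: Y_def)
  qed (auto simp: weight_exp_add_right Y_def blinfun.add_right)
  then have "image_mset (\<lambda>e'. h (\<alpha> e')) (mset_set ?A) = image_mset (\<lambda>e'. h (\<alpha> e')) (mset_set ?B)"
    unfolding h_def .
  moreover have "mset_set ?A = add_mset e (mset_set (?A - {e}))"
    using e by (intro mset_set.remove) auto
  moreover have "mset_set ?B = add_mset (arev e) (mset_set (?B - {arev e}))"
    using e by (intro mset_set.remove) auto
  \<comment> \<open>Both weights restrict to the trivial character on \<open>Y\<close>, so
    \<open>e\<close> and \<open>arev e\<close> can be cancelled from the two multisets.\<close>
  moreover have "h (\<alpha> (arev e)) = h (\<alpha> e)"
    unfolding h_def weight_arev[OF e]
    by (intro restrict_ext) (auto simp: Y_def weight_exp_eq_iff blinfun.diff_left blinfun.minus_left)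
  ultimately have img: "image_mset h (image_mset \<alpha> (mset_set (?A - {e}))) =
      image_mset h (image_mset \<alpha> (mset_set (?B - {arev e})))"
    by (simp add: image_mset.compositionality o_def)
  have "bino (\<alpha> e) dvd (\<Prod>\<beta>\<in>#image_mset \<alpha> (mset_set (?A - {e})). bino \<beta>) -
      (\<Prod>\<beta>\<in>#image_mset \<alpha> (mset_set (?B - {arev e})). bino \<beta>)"
  proof (rule dvd_prod_mset_diff[OF _ img])
    fix \<beta> \<gamma> assume h: "h \<beta> = h \<gamma>"
    have "blinfun_apply (\<gamma> - \<beta>) x \<in> \<int>" if "blinfun_apply (\<alpha> e) x \<in> \<int>" for x
    proof -
      have "weight_exp \<gamma> x = weight_exp \<beta> x"
        using fun_cong[OF h, of x] that by (simp add: h_def Y_def)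
      then show ?thesis
        by (simp only: weight_exp_eq_iff)
    qed
    then obtain m where "\<gamma> - \<beta> = of_int m *\<^sub>R \<alpha> e"
      using blinfun_eq_int_multiple[OF weight_nonzero[OF e]] by blast
    then have "bino (\<alpha> e) dvd expo \<gamma> - expo \<beta>"
      by (rule bino_dvd_expo_diff)
    then show "bino (\<alpha> e) dvd bino \<beta> - bino \<gamma>"
      by (simp add: bino_def)
  qed
  then show ?thesis
    by (simp add: prod_unfold_prod_mset image_mset.compositionality o_def)
qed

section \<open>Divisibility of the numerator by the common denominator\<close>

definition common_denominator :: "('g \<Rightarrow>\<^sub>L real) \<Rightarrow>\<^sub>0 int" where
  "common_denominator = (\<Prod>e\<in>arcs \<Gamma>. bino (\<alpha> e))"

text \<open>The localization summand at \<open>p\<close> multiplied by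
  \<open>common_denominator\<close>: the factors of the edges leaving \<open>p\<close> have been
  cancelled.\<close>

definition vertex_term :: "'v \<Rightarrow> ('g \<Rightarrow>\<^sub>L real) \<Rightarrow>\<^sub>0 int" where
  "vertex_term p = expo (a p) * (\<Prod>e\<in>arcs \<Gamma> - out_arcs \<Gamma> p. bino (\<alpha> e))"

definition numerator :: "('g \<Rightarrow>\<^sub>L real) \<Rightarrow>\<^sub>0 int" where
  "numerator = (\<Sum>p\<in>verts \<Gamma>. vertex_term p)"

text \<open>The scalar may be negative, so the class is closed under reversal of edges.\<close>

definition parallel :: "'e \<Rightarrow> 'e set" where
  "parallel e = {e' \<in> arcs \<Gamma>. \<exists>c. \<alpha> e' = c *\<^sub>R \<alpha> e}"

text \<open>This is the form in which the GKM condition is used: at each vertex at most one edge has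
  a given direction.\<close>

lemma tail_inj_on_parallel: "inj_on (tail \<Gamma>) (parallel e)"
proof (rule inj_onI, rule ccontr)
  fix e1 e2 assume *: "e1 \<in> parallel e" "e2 \<in> parallel e" "tail \<Gamma> e1 = tail \<Gamma> e2" "e1 \<noteq> e2"
  then have arcs: "e1 \<in> arcs \<Gamma>" "e2 \<in> arcs \<Gamma>"
    by (auto simp: parallel_def)
  obtain c1 c2 where c: "\<alpha> e1 = c1 *\<^sub>R \<alpha> e" "\<alpha> e2 = c2 *\<^sub>R \<alpha> e"
    using * by (auto simp: parallel_def)
  then have "c2 \<noteq> 0"
    using weight_nonzero[OF arcs(2)] by auto
  then have "\<alpha> e1 = (c1 / c2) *\<^sub>R \<alpha> e2"
    by (simp add: c)
  then have "\<alpha> e1 \<in> span {\<alpha> e2}"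
    by (simp add: span_base span_scale)
  moreover have "\<alpha> e1 \<noteq> \<alpha> e2" "independent {\<alpha> e1, \<alpha> e2}"
    using GKM[OF arcs *(4,3)] by auto
  ultimately show False
    by (simp add: independent_insert)
qed

lemma arev_parallel: "e' \<in> parallel e \<Longrightarrow> arev e' \<in> parallel e"
  by (auto simp: parallel_def weight_arev intro: exI[of _ "- _"] simp flip: scaleR_minus_left)

text \<open>Both terms contain one factor of the pair \<open>e'\<close>, \<open>arev e'\<close>, and
  these factors differ by minus an exponential. Modulo \<open>bino (\<alpha> e')\<close> the
  exponents \<open>a p\<close> and \<open>a q\<close> agree and so do the products over the other
  edges at the two ends, so the sum gains the missing factor. The other edges at \<open>p\<close>
  and \<open>q\<close> are not parallel to \<open>e\<close>, so the auxiliary product supplies their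
  factors.\<close>

lemma pair_dvd:
  assumes e: "e' \<in> parallel e"
  shows "common_denominator dvd
    (vertex_term (tail \<Gamma> e') + vertex_term (head \<Gamma> e')) * (\<Prod>i\<in>arcs \<Gamma> - parallel e. bino (\<alpha> i))"
proof -
  define p q where "p = tail \<Gamma> e'" and "q = head \<Gamma> e'"
  define A B R where "A = out_arcs \<Gamma> p - {e'}" and "B = out_arcs \<Gamma> q - {arev e'}"
    and "R = arcs \<Gamma> - out_arcs \<Gamma> p - out_arcs \<Gamma> q"
  let ?\<Pi> = "\<lambda>I. \<Prod>i\<in>I. bino (\<alpha> i)"
  have arc: "e' \<in> arcs \<Gamma>" and rev: "arev e' \<in> parallel e" "arev e' \<in> arcs \<Gamma>" "arev e' \<noteq> e'"
    using e arev_parallel by (auto simp: parallel_def arev_neq)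
  have pq: "p \<noteq> q"
    using inj_onD[OF tail_inj_on_parallel _ rev(1) e] rev(3) arc by (auto simp: p_def q_def)
  have fin: "finite A" "finite B" "finite R"
    by (auto simp: A_def B_def R_def)
  have disj: "A \<inter> B = {}" "A \<inter> R = {}" "B \<inter> R = {}" "e' \<notin> A" "e' \<notin> B" "e' \<notin> R"
    "arev e' \<notin> A" "arev e' \<notin> B" "arev e' \<notin> R"
    using pq arc rev by (auto simp: A_def B_def R_def p_def q_def)
  have sets: "arcs \<Gamma> - out_arcs \<Gamma> p = insert (arev e') (B \<union> R)"
    "arcs \<Gamma> - out_arcs \<Gamma> q = insert e' (A \<union> R)"
    "arcs \<Gamma> = insert e' (insert (arev e') (A \<union> B \<union> R))"
    using pq arc rev by (auto simp: A_def B_def R_def p_def q_def)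
  have D: "common_denominator = bino (\<alpha> e') * bino (- \<alpha> e') * ?\<Pi> A * ?\<Pi> B * ?\<Pi> R"
    unfolding common_denominator_def sets(3) using fin disj rev(3) weight_arev[OF arc]
    by (simp add: prod.union_disjoint Int_Un_distrib Int_Un_distrib2 ac_simps)
  have tp: "vertex_term p = expo (a p) * bino (- \<alpha> e') * ?\<Pi> B * ?\<Pi> R"
    unfolding vertex_term_def sets(1) using fin disj weight_arev[OF arc]
    by (simp add: prod.union_disjoint ac_simps)
  have tq: "vertex_term q = expo (a q) * bino (\<alpha> e') * ?\<Pi> A * ?\<Pi> R"
    unfolding vertex_term_def sets(2) using fin disj
    by (simp add: prod.union_disjoint ac_simps)
  have rev_bino: "bino (\<alpha> e') = - expo (\<alpha> e') * bino (- \<alpha> e')"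
    using bino_uminus[of "- \<alpha> e'"] by simp
  obtain m :: int where m: "a q - a p = of_int m *\<^sub>R \<alpha> e'"
    using moment[OF arc] by (auto simp: p_def q_def)
  have "bino (\<alpha> e') dvd expo (a p) - expo (a q + \<alpha> e')"
    \<comment> \<open>The extra \<open>\<alpha> e'\<close> comes from writing
      \<open>bino (\<alpha> e')\<close> as a unit times \<open>bino (- \<alpha> e')\<close> in the
      term of \<open>q\<close>; it turns the multiple \<open>- m\<close> into
      \<open>- (m + 1)\<close>.\<close>
    by (rule bino_dvd_expo_diff[of _ _ "- (m + 1)"]) (use m in \<open>simp add: algebra_simps\<close>)
  moreover have "bino (\<alpha> e') dvd ?\<Pi> A - ?\<Pi> B"
    using bino_dvd_edge_diff[OF arc] by (simp add: A_def B_def p_def q_def)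
  ultimately have "bino (\<alpha> e') dvd
      (expo (a p) - expo (a q + \<alpha> e')) * ?\<Pi> B - expo (a q + \<alpha> e') * (?\<Pi> A - ?\<Pi> B)"
    by (rule dvd_diff[OF dvd_mult2 dvd_mult])
  then obtain K where K: "expo (a p) * ?\<Pi> B - expo (a q) * expo (\<alpha> e') * ?\<Pi> A = bino (\<alpha> e') * K"
    by (auto elim!: dvdE simp: algebra_simps mult_single)
  have "vertex_term p + vertex_term q =
      bino (- \<alpha> e') * ?\<Pi> R * (expo (a p) * ?\<Pi> B - expo (a q) * expo (\<alpha> e') * ?\<Pi> A)"
    unfolding tp tq by (subst rev_bino) (simp add: algebra_simps)
  also have "\<dots> = bino (\<alpha> e') * bino (- \<alpha> e') * ?\<Pi> R * K"
    unfolding K by (simp only: ac_simps)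
  finally have sum: "vertex_term p + vertex_term q = bino (\<alpha> e') * bino (- \<alpha> e') * ?\<Pi> R * K" .
  have "A \<inter> parallel e = {}"
    using inj_onD[OF tail_inj_on_parallel _ _ e] by (auto simp: A_def p_def)
  moreover have "B \<inter> parallel e = {}"
    using inj_onD[OF tail_inj_on_parallel _ _ rev(1)] arc by (auto simp: B_def q_def)
  ultimately have "A \<union> B \<subseteq> arcs \<Gamma> - parallel e"
    by (auto simp: A_def B_def)
  then have "?\<Pi> (A \<union> B) dvd ?\<Pi> (arcs \<Gamma> - parallel e)"
    by (intro prod_dvd_prod_subset) auto
  then have "?\<Pi> A * ?\<Pi> B dvd ?\<Pi> (arcs \<Gamma> - parallel e)"
    using fin disj by (simp add: prod.union_disjoint)
  then have "bino (\<alpha> e') * bino (- \<alpha> e') * ?\<Pi> R * (?\<Pi> A * ?\<Pi> B) dvd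
      (vertex_term p + vertex_term q) * ?\<Pi> (arcs \<Gamma> - parallel e)"
    unfolding sum by (intro mult_dvd_mono dvd_triv_left) auto
  then show ?thesis
    unfolding D p_def[symmetric] q_def[symmetric] by (simp only: ac_simps)
qed

text \<open>
  The poles along the direction of \<open>\<alpha> e\<close> cancel in pairs: each vertex is the tail of at most one
  edge parallel to \<open>e\<close>, and that edge pairs it with its head.
\<close>
lemma common_denominator_dvd_mult:
  "common_denominator dvd numerator * (\<Prod>i\<in>arcs \<Gamma> - parallel e. bino (\<alpha> i))"
proof -
  let ?E = "\<Prod>i\<in>arcs \<Gamma> - parallel e. bino (\<alpha> i)"
  define L where "L = parallel e"
  \<comment> \<open>\<open>\<xi>\<close> picks one orientation of each edge in the class, so that
    every pair of ends is counted once.\<close>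
  define P where "P = {e' \<in> L. blinfun_apply (\<alpha> e') \<xi> > 0}"
  have L: "L \<subseteq> arcs \<Gamma>" "finite L"
    by (auto simp: L_def parallel_def)
  have fin: "finite P"
    using L by (simp add: P_def)
  have LP: "L = P \<union> arev ` P" "P \<inter> arev ` P = {}"
  proof -
    have "e' \<in> arev ` P" if "e' \<in> L" "e' \<notin> P" for e'
    proof -
      have "blinfun_apply (\<alpha> e') \<xi> < 0"
        using that generic[of e'] L by (force simp: P_def)
      then have "arev e' \<in> P"
        using that L arev_parallel by (auto simp: P_def L_def weight_arev blinfun.minus_left)
      then show ?thesis
        by (metis arev_arev image_eqI)
    qed
    then show "L = P \<union> arev ` P"
      using arev_parallel by (auto simp: P_def L_def)
    show "P \<inter> arev ` P = {}"
      using L by (auto simp: P_def weight_arev blinfun.minus_left subset_iff)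
  qed
  have inj: "inj_on arev P"
    by (metis arev_arev inj_onI)
  have "(\<Sum>p\<in>tail \<Gamma> ` L. vertex_term p) = (\<Sum>e'\<in>L. vertex_term (tail \<Gamma> e'))"
    using tail_inj_on_parallel by (simp add: L_def sum.reindex)
  also have "\<dots> = (\<Sum>e'\<in>P. vertex_term (tail \<Gamma> e')) + (\<Sum>e'\<in>arev ` P. vertex_term (tail \<Gamma> e'))"
    using LP fin by (metis finite_imageI sum.union_disjoint)
  also have "\<dots> = (\<Sum>e'\<in>P. vertex_term (tail \<Gamma> e') + vertex_term (head \<Gamma> e'))"
    using inj L by (auto simp: sum.reindex sum.distrib P_def intro!: sum.cong)
  finally have "(\<Sum>p\<in>tail \<Gamma> ` L. vertex_term p) * ?E =
      (\<Sum>e'\<in>P. (vertex_term (tail \<Gamma> e') + vertex_term (head \<Gamma> e')) * ?E)"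
    by (simp add: sum_distrib_right)
  also have "common_denominator dvd \<dots>"
    by (rule dvd_sum) (auto simp: P_def L_def intro: pair_dvd)
  finally have 1: "common_denominator dvd (\<Sum>p\<in>tail \<Gamma> ` L. vertex_term p) * ?E" .
  \<comment> \<open>No edge leaving such a vertex is parallel to \<open>e\<close>, so
    \<open>?E\<close> already contains all factors missing from its term.\<close>
  have 2: "common_denominator dvd vertex_term p * ?E" if "p \<notin> tail \<Gamma> ` L" for p
  proof -
    have sub: "out_arcs \<Gamma> p \<subseteq> arcs \<Gamma> - parallel e"
      using that by (auto simp: L_def)
    have "common_denominator =
        (\<Prod>i\<in>arcs \<Gamma> - out_arcs \<Gamma> p. bino (\<alpha> i)) * (\<Prod>i\<in>out_arcs \<Gamma> p. bino (\<alpha> i))"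
      unfolding common_denominator_def by (rule prod.subset_diff) auto
    moreover have "(\<Prod>i\<in>out_arcs \<Gamma> p. bino (\<alpha> i)) dvd ?E"
      using sub by (intro prod_dvd_prod_subset) auto
    ultimately show ?thesis
      unfolding vertex_term_def by (simp add: mult_dvd_mono)
  qed
  have "numerator = (\<Sum>p\<in>verts \<Gamma> - tail \<Gamma> ` L. vertex_term p) + (\<Sum>p\<in>tail \<Gamma> ` L. vertex_term p)"
    unfolding numerator_def using L by (intro sum.subset_diff) auto
  then have "numerator * ?E =
      (\<Sum>p\<in>verts \<Gamma> - tail \<Gamma> ` L. vertex_term p * ?E) + (\<Sum>p\<in>tail \<Gamma> ` L. vertex_term p) * ?E"
    by (simp add: distrib_right sum_distrib_right)
  moreover have "common_denominator dvd (\<Sum>p\<in>verts \<Gamma> - tail \<Gamma> ` L. vertex_term p * ?E)"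
    by (rule dvd_sum) (simp add: 2)
  ultimately show ?thesis
    using 1 by simp
qed

lemma additive_blinfun_apply: "Modules.additive (\<lambda>\<beta>::'g \<Rightarrow>\<^sub>L real. blinfun_apply \<beta> x)"
  by (simp add: Modules.additive_def blinfun.add_left)

text \<open>The factors are split off one at a time. If \<open>numerator\<close> is the product over
  \<open>S\<close> times \<open>M\<close>, the previous lemma and cancellation of the product over
  \<open>S\<close> show that \<open>bino (\<alpha> e)\<close> divides \<open>?E * M\<close>, and
  \<open>?E\<close> has only factors independent of \<open>\<alpha> e\<close>. Parallel weights are
  counted with multiplicity, since \<open>?E\<close> omits the whole class of
  \<open>e\<close>.\<close>

lemma common_denominator_dvd_numerator: "common_denominator dvd numerator"
proof -
  have "(\<Prod>i\<in>S. bino (\<alpha> i)) dvd numerator" if "finite S" "S \<subseteq> arcs \<Gamma>" for S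
    using that
  proof (induction S rule: finite_induct)
    case (insert e S)
    then obtain M where M: "numerator = (\<Prod>i\<in>S. bino (\<alpha> i)) * M"
      by (auto elim: dvdE)
    let ?E = "\<Prod>i\<in>arcs \<Gamma> - parallel e. bino (\<alpha> i)"
    obtain K where K: "numerator * ?E = common_denominator * K"
      using common_denominator_dvd_mult by (metis dvdE)
    have "common_denominator = (\<Prod>i\<in>arcs \<Gamma> - insert e S. bino (\<alpha> i)) * (\<Prod>i\<in>insert e S. bino (\<alpha> i))"
      unfolding common_denominator_def by (rule prod.subset_diff) (use insert.prems in auto)
    also have "\<dots> = (\<Prod>i\<in>S. bino (\<alpha> i)) * (bino (\<alpha> e) * (\<Prod>i\<in>arcs \<Gamma> - insert e S. bino (\<alpha> i)))"
      using insert.hyps by (simp add: ac_simps)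
    finally have "(\<Prod>i\<in>S. bino (\<alpha> i)) *
        (?E * M - bino (\<alpha> e) * (\<Prod>i\<in>arcs \<Gamma> - insert e S. bino (\<alpha> i)) * K) = 0"
      using K unfolding M by (simp add: right_diff_distrib ac_simps)
    then have "?E * M - bino (\<alpha> e) * (\<Prod>i\<in>arcs \<Gamma> - insert e S. bino (\<alpha> i)) * K = 0"
      by (rule prod_bino_mult_eq_0[OF additive_blinfun_apply[of \<xi>], rotated])
        (use generic insert.prems in auto)
    then have "bino (\<alpha> e) dvd ?E * M"
      by (simp add: mult.assoc)
    then have "bino (\<alpha> e) dvd M"
    proof (rule bino_dvd_prod_bino_mult[rotated])
      fix i assume i: "i \<in> arcs \<Gamma> - parallel e"
      \<comment> \<open>As \<open>\<alpha> i\<close> is no multiple of \<open>\<alpha> e\<close>,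
        some vector in the kernel of \<open>\<alpha> e\<close> is not killed by
        \<open>\<alpha> i\<close>; evaluation there is the separating grading.\<close>
      then obtain x where "blinfun_apply (\<alpha> e) x = 0" "blinfun_apply (\<alpha> i) x \<noteq> 0"
        using blinfun_eq_scaleR_of_kernel_subset[of "\<alpha> e" "\<alpha> i"] by (auto simp: parallel_def)
      then show "\<exists>t. Modules.additive t \<and> t (\<alpha> e) = (0::real) \<and> t (\<alpha> i) \<noteq> 0"
        using additive_blinfun_apply by (intro exI[of _ "\<lambda>\<beta>. blinfun_apply \<beta> x"]) auto
    qed
    then show ?case
      using insert.hyps unfolding M by (simp add: mult.commute mult_dvd_mono)
  qed simp
  then show ?thesis
    by (simp add: common_denominator_def)
qed

text \<open>A loop and its reversal would be two parallel edges with the same tail.\<close>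

lemma no_loops: "e \<in> arcs \<Gamma> \<Longrightarrow> tail \<Gamma> e \<noteq> head \<Gamma> e"
proof
  assume e: "e \<in> arcs \<Gamma>" and "tail \<Gamma> e = head \<Gamma> e"
  then have "tail \<Gamma> (arev e) = tail \<Gamma> e"
    by simp
  moreover have "e \<in> parallel e"
    using e scaleR_one[of "\<alpha> e", symmetric] unfolding parallel_def by blast
  ultimately have "arev e = e"
    using inj_onD[OF tail_inj_on_parallel] arev_parallel by blast
  then show False
    using arev_neq[OF e] by simp
qed

section \<open>Expansion of the vertex terms along \<open>\<xi>\<close>\<close>

definition incoming_weight :: "'v \<Rightarrow> 'g \<Rightarrow>\<^sub>L real" where
  "incoming_weight p = (\<Sum>e\<in>positive_edges \<Gamma> \<alpha> \<xi> p. if tail \<Gamma> e = p then 0 else \<alpha> e)"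

text \<open>Positive edges leaving \<open>p\<close> cancel in the difference, while those with sign
  -1 are doubled, which absorbs the factor one half.\<close>

lemma delta_diff: "delta \<Gamma> \<alpha> \<xi> p - delta_sharp \<Gamma> \<alpha> \<xi> p = incoming_weight p"
proof -
  let ?P = "positive_edges \<Gamma> \<alpha> \<xi> p"
  have "delta \<Gamma> \<alpha> \<xi> p - delta_sharp \<Gamma> \<alpha> \<xi> p =
      (\<Sum>e\<in>?P. (1 / 2) *\<^sub>R (\<alpha> e - of_int (edge_sign \<Gamma> p e) *\<^sub>R \<alpha> e))"
    unfolding delta_def delta_sharp_def scaleR_sum_right[symmetric] sum_subtractf
    by (rule scaleR_diff_right[symmetric])
  also have "\<dots> = incoming_weight p"
    unfolding incoming_weight_def
  proof (rule sum.cong[OF refl])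
    fix e
    have "(1 / 2) *\<^sub>R (\<alpha> e + \<alpha> e) = \<alpha> e"
      by (metis scaleR_half_double)
    then show "(1 / 2) *\<^sub>R (\<alpha> e - of_int (edge_sign \<Gamma> p e) *\<^sub>R \<alpha> e) = (if tail \<Gamma> e = p then 0 else \<alpha> e)"
      by (simp add: edge_sign_def)
  qed
  finally show ?thesis .
qed

lemma finite_positive_edges: "finite (positive_edges \<Gamma> \<alpha> \<xi> p)"
  by (simp add: positive_edges_def)

text \<open>An edge leaving \<open>p\<close> with a negative weight is the reversal of a positive
  edge arriving there. Turning it around costs the unit of \<open>bino_uminus\<close>; the units
  together give the sign of \<open>p\<close> and the exponential of
  \<open>incoming_weight p\<close>.\<close>

lemma prod_positive_edges:
  "of_int (vertex_sign \<Gamma> \<alpha> \<xi> p) * expo (incoming_weight p) * (\<Prod>e\<in>out_arcs \<Gamma> p. bino (\<alpha> e)) =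
    (\<Prod>e\<in>positive_edges \<Gamma> \<alpha> \<xi> p. bino (\<alpha> e))"
proof -
  define A where "A = {e \<in> out_arcs \<Gamma> p. blinfun_apply (\<alpha> e) \<xi> > 0}"
  define B where "B = {e \<in> in_arcs \<Gamma> p. blinfun_apply (\<alpha> e) \<xi> > 0}"
  have fin: "finite A" "finite B"
    by (auto simp: A_def B_def in_arcs_def out_arcs_def)
  have AB: "A \<inter> B = {}"
    using no_loops[symmetric] by (auto simp: A_def B_def)
  have pos: "positive_edges \<Gamma> \<alpha> \<xi> p = A \<union> B"
    by (auto simp: positive_edges_def A_def B_def)
  have rev: "e \<in> arev ` B" if "e \<in> out_arcs \<Gamma> p" "e \<notin> A" for e
  proof -
    have "arev e \<in> B"
      using that generic[of e] by (force simp: A_def B_def weight_arev blinfun.minus_left)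
    then show ?thesis
      by (metis arev_arev image_eqI)
  qed
  have "out_arcs \<Gamma> p \<subseteq> A \<union> arev ` B"
  proof
    show "e \<in> A \<union> arev ` B" if "e \<in> out_arcs \<Gamma> p" for e
      using rev[OF that] by (cases "e \<in> A") (simp_all only: Un_iff simp_thms)
  qed
  moreover have "A \<union> arev ` B \<subseteq> out_arcs \<Gamma> p"
  proof
    show "e \<in> out_arcs \<Gamma> p" if "e \<in> A \<union> arev ` B" for e
      using that by (elim UnE imageE) (simp_all add: A_def B_def)
  qed
  ultimately have out: "out_arcs \<Gamma> p = A \<union> arev ` B"
    by (rule equalityI)
  have "arev x \<notin> A" if "x \<in> B" for x
    using that by (simp add: A_def B_def weight_arev blinfun.minus_left)
  then have AB': "A \<inter> arev ` B = {}"
    unfolding disjoint_iff by (metis imageE)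
  have inj: "inj_on arev B"
    by (metis arev_arev inj_onI)
  have "of_int (vertex_sign \<Gamma> \<alpha> \<xi> p) * expo (incoming_weight p) =
      (\<Prod>e\<in>A \<union> B. of_int (edge_sign \<Gamma> p e) * expo (if tail \<Gamma> e = p then 0 else \<alpha> e))"
    by (simp only: vertex_sign_def incoming_weight_def expo_sum pos prod.distrib of_int_prod)
  also have "\<dots> = (\<Prod>e\<in>A. of_int (edge_sign \<Gamma> p e) * expo (if tail \<Gamma> e = p then 0 else \<alpha> e)) *
      (\<Prod>e\<in>B. of_int (edge_sign \<Gamma> p e) * expo (if tail \<Gamma> e = p then 0 else \<alpha> e))"
    using fin AB by (rule prod.union_disjoint)
  also have "(\<Prod>e\<in>A. of_int (edge_sign \<Gamma> p e) * expo (if tail \<Gamma> e = p then 0 else \<alpha> e)) = 1"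
    by (rule prod.neutral) (simp add: A_def edge_sign_def)
  also have "(\<Prod>e\<in>B. of_int (edge_sign \<Gamma> p e) * expo (if tail \<Gamma> e = p then 0 else \<alpha> e)) =
      (\<Prod>e\<in>B. - expo (\<alpha> e))"
  proof (rule prod.cong[OF refl])
    fix e assume "e \<in> B"
    then have "tail \<Gamma> e \<noteq> p"
      using no_loops[of e] by (auto simp: B_def)
    then show "of_int (edge_sign \<Gamma> p e) * expo (if tail \<Gamma> e = p then 0 else \<alpha> e) = - expo (\<alpha> e)"
      by (simp add: edge_sign_def)
  qed
  finally have sign: "of_int (vertex_sign \<Gamma> \<alpha> \<xi> p) * expo (incoming_weight p) = (\<Prod>e\<in>B. - expo (\<alpha> e))"
    by simp
  have "(\<Prod>e\<in>out_arcs \<Gamma> p. bino (\<alpha> e)) = (\<Prod>e\<in>A. bino (\<alpha> e)) * (\<Prod>e\<in>arev ` B. bino (\<alpha> e))"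
    unfolding out using fin AB' by (intro prod.union_disjoint) auto
  also have "(\<Prod>e\<in>arev ` B. bino (\<alpha> e)) = (\<Prod>e\<in>B. bino (- \<alpha> e))"
    unfolding prod.reindex[OF inj] o_def by (rule prod.cong) (simp_all add: weight_arev B_def)
  finally have "of_int (vertex_sign \<Gamma> \<alpha> \<xi> p) * expo (incoming_weight p) * (\<Prod>e\<in>out_arcs \<Gamma> p. bino (\<alpha> e)) =
      (\<Prod>e\<in>A. bino (\<alpha> e)) * (\<Prod>e\<in>B. - expo (\<alpha> e) * bino (- \<alpha> e))"
    unfolding sign prod.distrib by (simp only: ac_simps)
  also have "(\<Prod>e\<in>B. - expo (\<alpha> e) * bino (- \<alpha> e)) = (\<Prod>e\<in>B. bino (\<alpha> e))"
  proof (rule prod.cong[OF refl])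
    show "- expo (\<alpha> e) * bino (- \<alpha> e) = bino (\<alpha> e)" for e
      using bino_uminus[of "- \<alpha> e"] by simp
  qed
  also have "(\<Prod>e\<in>A. bino (\<alpha> e)) * \<dots> = (\<Prod>e\<in>A \<union> B. bino (\<alpha> e))"
    using fin AB by (rule prod.union_disjoint[symmetric])
  finally show ?thesis
    by (simp only: pos)
qed

lemma linear_blinfun_apply: "linear (\<lambda>\<beta>::'g \<Rightarrow>\<^sub>L real. blinfun_apply \<beta> x)"
  by (rule linearI) (simp_all add: blinfun.add_left blinfun.scaleR_left)

text \<open>The series \<open>F\<close> of the overview: the right-hand side of the theorem, with
  its two half-sums merged into \<open>incoming_weight\<close>.\<close>

definition partition_sum :: "('g \<Rightarrow>\<^sub>L real) \<Rightarrow> int" where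
  "partition_sum \<beta> = (\<Sum>p\<in>verts \<Gamma>. vertex_sign \<Gamma> \<alpha> \<xi> p *
     int (kostant_partition \<Gamma> \<alpha> \<xi> p (\<beta> - (a p + incoming_weight p))))"

lemma kostant_partition_eq: "kostant_partition \<Gamma> \<alpha> \<xi> p \<beta> = card (partitions \<alpha> (positive_edges \<Gamma> \<alpha> \<xi> p) \<beta>)"
  by (simp add: kostant_partition_def partitions_def)

text \<open>At each vertex the sign and the shift turn the product over the outgoing edges into the
  one over the positive edges. This product is inverted by the partition function, and
  \<open>vertex_term p\<close> remains.\<close>

lemma formal_action_partition_sum:
  "formal_action common_denominator partition_sum = Poly_Mapping.lookup numerator"
proof (rule ext)
  fix \<beta>
  let ?K = "\<lambda>p \<gamma>. int (kostant_partition \<Gamma> \<alpha> \<xi> p \<gamma>)"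
  have "partition_sum = (\<lambda>\<beta>. \<Sum>p\<in>verts \<Gamma>. vertex_sign \<Gamma> \<alpha> \<xi> p *
      formal_action (expo (a p + incoming_weight p)) (?K p) \<beta>)"
    by (simp only: partition_sum_def formal_action_expo fun_eq_iff) simp
  then have "formal_action common_denominator partition_sum \<beta> = (\<Sum>p\<in>verts \<Gamma>. formal_action
      (of_int (vertex_sign \<Gamma> \<alpha> \<xi> p) * (common_denominator * expo (a p + incoming_weight p))) (?K p) \<beta>)"
    by (simp add: formal_action_sum_right formal_action_cmult_right formal_action_of_int_mult
        flip: formal_action_mult)
  also have "\<dots> = (\<Sum>p\<in>verts \<Gamma>. Poly_Mapping.lookup (vertex_term p) \<beta>)"
  proof (rule sum.cong[OF refl])
    fix p
    have "common_denominator =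
        (\<Prod>i\<in>arcs \<Gamma> - out_arcs \<Gamma> p. bino (\<alpha> i)) * (\<Prod>i\<in>out_arcs \<Gamma> p. bino (\<alpha> i))"
      unfolding common_denominator_def by (rule prod.subset_diff) auto
    then have "of_int (vertex_sign \<Gamma> \<alpha> \<xi> p) * (common_denominator * expo (a p + incoming_weight p)) =
        vertex_term p * (\<Prod>e\<in>positive_edges \<Gamma> \<alpha> \<xi> p. bino (\<alpha> e))"
      unfolding prod_positive_edges[symmetric] vertex_term_def expo_add by (simp only: ac_simps)
    moreover have "formal_action (\<Prod>e\<in>positive_edges \<Gamma> \<alpha> \<xi> p. bino (\<alpha> e)) (?K p) = Poly_Mapping.lookup 1"
      unfolding kostant_partition_eq
      by (rule formal_action_prod_bino_partitions[OF linear_blinfun_apply[of \<xi>] finite_positive_edges])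
        (simp add: positive_edges_def)
    ultimately show "formal_action (of_int (vertex_sign \<Gamma> \<alpha> \<xi> p) *
        (common_denominator * expo (a p + incoming_weight p))) (?K p) \<beta> = Poly_Mapping.lookup (vertex_term p) \<beta>"
      by (simp only: formal_action_mult formal_action_lookup mult_1_right)
  qed
  finally show "formal_action common_denominator partition_sum \<beta> = Poly_Mapping.lookup numerator \<beta>"
    by (simp add: numerator_def lookup_sum)
qed

section \<open>Comparison of the expansion with the quotient\<close>

lemma partition_sum_nonzeroE:
  assumes "partition_sum \<beta> \<noteq> 0"
  obtains p k where "p \<in> verts \<Gamma>"
    and "k \<in> partitions \<alpha> (positive_edges \<Gamma> \<alpha> \<xi> p) (\<beta> - (a p + incoming_weight p))"
proof -
  have "\<exists>p\<in>verts \<Gamma>. kostant_partition \<Gamma> \<alpha> \<xi> p (\<beta> - (a p + incoming_weight p)) \<noteq> 0"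
  proof (rule ccontr)
    assume "\<not> ?thesis"
    then have "partition_sum \<beta> = 0"
      unfolding partition_sum_def by (intro sum.neutral) simp
    then show False
      using assms by contradiction
  qed
  then obtain p where p: "p \<in> verts \<Gamma>"
    and nz: "kostant_partition \<Gamma> \<alpha> \<xi> p (\<beta> - (a p + incoming_weight p)) \<noteq> 0"
    by blast
  have "partitions \<alpha> (positive_edges \<Gamma> \<alpha> \<xi> p) (\<beta> - (a p + incoming_weight p)) \<noteq> {}"
    unfolding kostant_partition_eq using nz by (intro notI) (simp add: kostant_partition_eq)
  then show ?thesis
    using that p by blast
qed

text \<open>Both series become \<open>numerator\<close> under \<open>common_denominator\<close>, and
  their difference is bounded below along \<open>\<xi>\<close>.\<close>

lemma lookup_quotient:
  assumes M: "numerator = common_denominator * M"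
  shows "Poly_Mapping.lookup M = partition_sum"
proof (rule ext)
  fix \<beta>
  \<comment> \<open>The values on \<open>\<xi>\<close> of the apexes of the cones supporting the
    partition functions and of the finitely many exponents of \<open>M\<close>; the least of them
    bounds the support of the difference.\<close>
  define T where "T = (\<lambda>p. blinfun_apply (a p + incoming_weight p) \<xi>) ` verts \<Gamma> \<union>
    (\<lambda>\<beta>. blinfun_apply \<beta> \<xi>) ` Poly_Mapping.keys M"
  have T: "finite T"
    by (simp add: T_def)
  have "partition_sum \<beta> - Poly_Mapping.lookup M \<beta> = 0"
  proof (rule formal_action_prod_bino_eq_0[where F = "\<lambda>\<beta>. partition_sum \<beta> - Poly_Mapping.lookup M \<beta>"
      and c = "Min T" and I = "arcs \<Gamma>" and u = \<alpha>, OF additive_blinfun_apply[of \<xi>]])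
    show "formal_action (\<Prod>i\<in>arcs \<Gamma>. bino (\<alpha> i)) (\<lambda>\<beta>. partition_sum \<beta> - Poly_Mapping.lookup M \<beta>) \<beta> = 0" for \<beta>
      unfolding common_denominator_def[symmetric] formal_action_diff_right
      by (simp add: formal_action_partition_sum formal_action_lookup M)
    show "Min T \<le> blinfun_apply \<beta> \<xi>" if nz: "partition_sum \<beta> - Poly_Mapping.lookup M \<beta> \<noteq> 0" for \<beta>
    proof (cases "partition_sum \<beta> = 0")
      case True
      then have "\<beta> \<in> Poly_Mapping.keys M"
        using nz by (simp add: in_keys_iff)
      then show ?thesis
        using T by (intro Min_le) (auto simp: T_def)
    next
      case False
      then obtain p k where p: "p \<in> verts \<Gamma>"
        and k: "k \<in> partitions \<alpha> (positive_edges \<Gamma> \<alpha> \<xi> p) (\<beta> - (a p + incoming_weight p))"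
        by (rule partition_sum_nonzeroE)
      have "blinfun_apply (\<beta> - (a p + incoming_weight p)) \<xi> \<ge> 0"
        by (rule partitions_nonneg(2)[OF linear_blinfun_apply[of \<xi>] _ k]) (simp add: positive_edges_def)
      moreover have "Min T \<le> blinfun_apply (a p + incoming_weight p) \<xi>"
        using T p by (intro Min_le) (auto simp: T_def)
      ultimately show ?thesis
        by (simp add: blinfun.diff_left)
    qed
  qed (use generic in auto)
  then show "Poly_Mapping.lookup M \<beta> = partition_sum \<beta>"
    by simp
qed

lemma partition_sum_support:
  assumes "partition_sum \<beta> \<noteq> 0"
  shows "\<beta> \<in> weight_lattice G"
proof -
  obtain p k where p: "p \<in> verts \<Gamma>"
    and k: "k \<in> partitions \<alpha> (positive_edges \<Gamma> \<alpha> \<xi> p) (\<beta> - (a p + incoming_weight p))"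
    using assms by (rule partition_sum_nonzeroE)
  have "incoming_weight p \<in> weight_lattice G"
    unfolding incoming_weight_def
    by (intro weight_lattice_sum) (auto simp: positive_edges_def weight weight_lattice_0)
  moreover have "\<beta> - (a p + incoming_weight p) \<in> weight_lattice G"
  proof -
    have eq: "\<beta> - (a p + incoming_weight p) = (\<Sum>e\<in>positive_edges \<Gamma> \<alpha> \<xi> p. real (k e) *\<^sub>R \<alpha> e)"
      using k unfolding partitions_def by blast
    show ?thesis
      unfolding eq
      by (intro weight_lattice_sum weight_lattice_scale weight) (simp add: positive_edges_def)
  qed
  ultimately have "(a p + incoming_weight p) + (\<beta> - (a p + incoming_weight p)) \<in> weight_lattice G"
    using vertex_weight[OF p] by (intro weight_lattice_add)
  then show ?thesis by simp
qed

text \<open>At a regular element the evaluated denominator is nonzero and can be divided out, so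
  \<open>M\<close> evaluates to the localization sum. Density of regular elements gives the
  uniqueness required by the definite description.\<close>

lemma Q_character_eq:
  assumes M: "numerator = common_denominator * M"
    and f: "\<And>p. p \<in> verts \<Gamma> \<Longrightarrow> f p = weight_char G (a p)"
  shows "Q_character G \<Gamma> \<alpha> f = (\<lambda>g\<in>carrier G. lin_ext (\<lambda>\<beta>. weight_char G \<beta> g) M)"
    (is "_ = ?\<phi>")
proof -
  have keys: "Poly_Mapping.keys M \<subseteq> weight_lattice G"
    using partition_sum_support by (auto simp: in_keys_iff lookup_quotient[OF M])
  have formula: "?\<phi> g = (\<Sum>p\<in>verts \<Gamma>. f p g * (\<Prod>e\<in>out_arcs \<Gamma> p. inverse (1 - weight_char G (\<alpha> e) g)))"
    if g: "g \<in> regular_elements G \<Gamma> \<alpha>" for g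
  proof -
    have "g \<in> carrier G"
      using g by (simp add: regular_elements_def)
    then obtain x where x: "g = gexp G x"
      by (rule carrier_gexpE)
    define c where "c e = 1 - weight_exp (\<alpha> e) x" for e
    have c: "c e \<noteq> 0" "1 - weight_char G (\<alpha> e) g = c e" if "e \<in> arcs \<Gamma>" for e
      using g that by (auto simp: regular_elements_def x weight_char_gexp weight c_def)
    let ?ev = "lin_ext (\<lambda>\<beta>. weight_exp \<beta> x)"
    have ev_bino: "?ev (bino (\<alpha> e)) = c e" for e
      by (simp add: bino_def lin_ext_diff lin_ext_one lin_ext_single c_def)
    have ev_prod: "?ev (\<Prod>e\<in>I. bino (\<alpha> e)) = (\<Prod>e\<in>I. c e)" for I
      by (simp add: lin_ext_prod_hom weight_exp_add ev_bino)
    have "?ev numerator = (\<Sum>p\<in>verts \<Gamma>. weight_exp (a p) x * (\<Prod>e\<in>arcs \<Gamma> - out_arcs \<Gamma> p. c e))"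
      by (simp add: numerator_def vertex_term_def lin_ext_sum lin_ext_mult_hom weight_exp_add lin_ext_single ev_prod)
    also have "\<dots> = (\<Sum>p\<in>verts \<Gamma>. (\<Prod>e\<in>arcs \<Gamma>. c e) * (f p g * (\<Prod>e\<in>out_arcs \<Gamma> p. inverse (1 - weight_char G (\<alpha> e) g))))"
    proof (rule sum.cong[OF refl])
      fix p assume p: "p \<in> verts \<Gamma>"
      have split: "(\<Prod>e\<in>arcs \<Gamma>. c e) = (\<Prod>e\<in>arcs \<Gamma> - out_arcs \<Gamma> p. c e) * (\<Prod>e\<in>out_arcs \<Gamma> p. c e)"
        by (rule prod.subset_diff) auto
      have "(\<Prod>e\<in>out_arcs \<Gamma> p. c e) \<noteq> 0"
        using c(1) by (simp add: finite_out_arcs)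
      moreover have "(\<Prod>e\<in>out_arcs \<Gamma> p. inverse (1 - weight_char G (\<alpha> e) g)) =
          (\<Prod>e\<in>out_arcs \<Gamma> p. inverse (c e))"
        by (rule prod.cong) (simp_all add: c(2))
      moreover have "\<dots> = inverse (\<Prod>e\<in>out_arcs \<Gamma> p. c e)"
        using prod_inversef[of c "out_arcs \<Gamma> p"] by (simp only: o_def)
      ultimately show "weight_exp (a p) x * (\<Prod>e\<in>arcs \<Gamma> - out_arcs \<Gamma> p. c e) =
          (\<Prod>e\<in>arcs \<Gamma>. c e) * (f p g * (\<Prod>e\<in>out_arcs \<Gamma> p. inverse (1 - weight_char G (\<alpha> e) g)))"
        by (simp add: split f[OF p] x weight_char_gexp[OF vertex_weight[OF p]])
    qed
    finally have "(\<Prod>e\<in>arcs \<Gamma>. c e) * ?ev M = (\<Prod>e\<in>arcs \<Gamma>. c e) *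
        (\<Sum>p\<in>verts \<Gamma>. f p g * (\<Prod>e\<in>out_arcs \<Gamma> p. inverse (1 - weight_char G (\<alpha> e) g)))"
      by (simp add: M common_denominator_def lin_ext_mult_hom weight_exp_add ev_prod sum_distrib_left)
    moreover have "(\<Prod>e\<in>arcs \<Gamma>. c e) \<noteq> 0"
      using c(1) by simp
    ultimately have "?ev M = (\<Sum>p\<in>verts \<Gamma>. f p g * (\<Prod>e\<in>out_arcs \<Gamma> p. inverse (1 - weight_char G (\<alpha> e) g)))"
      by simp
    moreover have "?\<phi> g = ?ev M"
      unfolding lin_ext_def x using keys by (auto simp: weight_char_gexp intro!: sum.cong)
    ultimately show ?thesis by simp
  qed
  show ?thesis
    unfolding Q_character_def
  proof (rule the_equality)
    show "?\<phi> \<in> character_ring G (carrier G) \<and> (\<forall>g\<in>regular_elements G \<Gamma> \<alpha>.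
        ?\<phi> g = (\<Sum>p\<in>verts \<Gamma>. f p g * (\<Prod>e\<in>out_arcs \<Gamma> p. inverse (1 - weight_char G (\<alpha> e) g))))"
      by (intro conjI ballI lin_ext_in_character_ring[OF keys] formula)
    fix \<psi> assume \<psi>: "\<psi> \<in> character_ring G (carrier G) \<and> (\<forall>g\<in>regular_elements G \<Gamma> \<alpha>.
        \<psi> g = (\<Sum>p\<in>verts \<Gamma>. f p g * (\<Prod>e\<in>out_arcs \<Gamma> p. inverse (1 - weight_char G (\<alpha> e) g))))"
    show "\<psi> = ?\<phi>"
    proof (rule character_ring_eqI[of _ _ "\<alpha> ` arcs \<Gamma>" \<xi>])
      show "\<psi> g = ?\<phi> g" if "g \<in> carrier G" "\<forall>\<beta>\<in>\<alpha> ` arcs \<Gamma>. weight_char G \<beta> g \<noteq> 1" for g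
      proof -
        have "g \<in> regular_elements G \<Gamma> \<alpha>"
          using that by (simp add: regular_elements_def)
        then show ?thesis
          using \<psi> by (simp only: formula)
      qed
      show "\<psi> \<in> character_ring G (carrier G)" "?\<phi> \<in> character_ring G (carrier G)"
        using \<psi> lin_ext_in_character_ring[OF keys] by simp_all
    qed (use weight generic in auto)
  qed
qed

end

theorem theorem1p4:
  fixes G :: "('a, 'g::euclidean_space, 'm) lie_group_scheme"
    and \<Gamma> :: "('v, 'e) pre_digraph"
    and arev :: "'e \<Rightarrow> 'e"
    and n d :: nat
    and \<alpha> :: "'e \<Rightarrow> 'g \<Rightarrow>\<^sub>L real"
    and \<rho> :: "'e \<Rightarrow> 'a \<Rightarrow> complex mat"
    and \<tau> :: "'v \<Rightarrow> 'a \<Rightarrow> complex mat"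
    and f :: "'v \<Rightarrow> 'a \<Rightarrow> complex"
    and a :: "'v \<Rightarrow> 'g \<Rightarrow>\<^sub>L real"
    and \<xi> :: 'g
    and \<beta> :: "'g \<Rightarrow>\<^sub>L real"
  assumes "GKM_action G n \<Gamma> arev d \<alpha> \<rho> \<tau>"
    and "symplectic G \<Gamma> \<alpha> f a"
    and "\<forall>e\<in>arcs \<Gamma>. blinfun_apply (\<alpha> e) \<xi> \<noteq> 0"
    and "\<beta> \<in> weight_lattice G"
  shows "weight_multiplicity G (Q_character G \<Gamma> \<alpha> f) \<beta> =
    (\<Sum>p\<in>verts \<Gamma>. vertex_sign \<Gamma> \<alpha> \<xi> p *
       int (kostant_partition \<Gamma> \<alpha> \<xi> p (\<beta> - a p + delta_sharp \<Gamma> \<alpha> \<xi> p - delta \<Gamma> \<alpha> \<xi> p)))"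
proof -
  interpret GKM_action G n \<Gamma> arev d \<alpha> \<rho> \<tau> by fact
  interpret localization_data G n \<Gamma> arev d \<alpha> \<rho> \<tau> a \<xi>
    by unfold_locales (use assms(2,3) in \<open>auto simp: symplectic_def\<close>)
  \<comment> \<open>The existence of \<open>M\<close> is the integrality statement that the
    localization sum is an element of the character ring.\<close>
  obtain M where M: "numerator = common_denominator * M"
    using common_denominator_dvd_numerator by (metis dvdE)
  have keys: "Poly_Mapping.keys M \<subseteq> weight_lattice G"
    using partition_sum_support by (auto simp: in_keys_iff lookup_quotient[OF M])
  have "Q_character G \<Gamma> \<alpha> f = (\<lambda>g\<in>carrier G. lin_ext (\<lambda>\<beta>. weight_char G \<beta> g) M)"
    using assms(2) by (intro Q_character_eq[OF M]) (simp add: symplectic_def)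
  then have "weight_multiplicity G (Q_character G \<Gamma> \<alpha> f) \<beta> = partition_sum \<beta>"
    by (simp add: weight_multiplicity_lin[OF keys] lookup_quotient[OF M])
  moreover have "\<beta> - (a p + incoming_weight p) = \<beta> - a p + delta_sharp \<Gamma> \<alpha> \<xi> p - delta \<Gamma> \<alpha> \<xi> p" for p
    by (simp flip: delta_diff)
  ultimately show ?thesis
    by (simp add: partition_sum_def)
qed

end
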